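(* Let $G=(C_4\rtimes C_4)\times E$, where $C_4\rtimes C_4=\langle a,b\mid a^4=b^4=1,\ (a,b)=a^2\rangle$ and $E$ is a finite elementary abelian $2$-group. Let $F$ be a finite field of characteristic two. Then \[ |V_*(FG)|=4\cdot |F|^{\frac{1}{2}(|G|+|G_T|)-1}. \]
   Context: For a finite $2$-group $G$ and a finite field $F$ of characteristic two, $FG$ is the group algebra, and $*$ is the classical involution of $FG$, i.e. the $F$-linear extension of $g\mapsto g^{-1}$ ($g\in G$). $V(FG)$ is the group of normalized units of $FG$ (units whose coefficients sum to $1$). $V_*(FG)=\{u\in V(FG) : u^*=u^{-1}\}$. $G_T=\{g\in G : g^2=1\}$ (so $1\in G_T$). $(x,y)=x^{-1}y^{-1}xy$ denotes the commutator. *)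

theory Defs
  imports Complex_Main "HOL-Algebra.Group" "HOL-Algebra.Coset" "HOL-Algebra.Ring"
    "HOL-Computational_Algebra.Primes" "HOL-Library.Cardinality"
begin

datatype 'x letter = Gen 'x | GenInv 'x

type_synonym 'x word = "'x letter list"

fun letter_inv :: "'x letter \<Rightarrow> 'x letter" where
  "letter_inv (Gen x) = GenInv x"
| "letter_inv (GenInv x) = Gen x"

definition word_inv :: "'x word \<Rightarrow> 'x word" where
  "word_inv w = rev (map letter_inv w)"

definition word_pow :: "'x word \<Rightarrow> nat \<Rightarrow> 'x word" where
  "word_pow w n = concat (replicate n w)"

definition word_comm :: "'x word \<Rightarrow> 'x word \<Rightarrow> 'x word" where
  "word_comm u v = word_inv u @ word_inv v @ u @ v"

text \<open>
  The least congruence on the monoid of words that contains free cancellation and all the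
  relations \<open>u = v\<close> with \<open>(u, v) \<in> R\<close>.
\<close>

inductive_set word_cong :: "('x word \<times> 'x word) set \<Rightarrow> ('x word \<times> 'x word) set"
  for R :: "('x word \<times> 'x word) set" where
  relation: "(u, v) \<in> R \<Longrightarrow> (u, v) \<in> word_cong R"
| cancel: "([l, letter_inv l], []) \<in> word_cong R"
| refl: "(u, u) \<in> word_cong R"
| sym: "(u, v) \<in> word_cong R \<Longrightarrow> (v, u) \<in> word_cong R"
| trans: "(u, v) \<in> word_cong R \<Longrightarrow> (v, w) \<in> word_cong R \<Longrightarrow> (u, w) \<in> word_cong R"
| append: "(u, u') \<in> word_cong R \<Longrightarrow> (v, v') \<in> word_cong R \<Longrightarrow> (u @ v, u' @ v') \<in> word_cong R"

text \<open>The group generated by all elements of the type \<open>'x\<close> subject to the relations in \<open>R\<close>.\<close>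

definition presented_group :: "('x word \<times> 'x word) set \<Rightarrow> 'x word set monoid" where
  "presented_group R =
    \<lparr> carrier = UNIV // word_cong R,
      monoid.mult = (\<lambda>A B. \<Union>u\<in>A. \<Union>v\<in>B. word_cong R `` {u @ v}),
      one = word_cong R `` {[]} \<rparr>"

lemma equiv_word_cong: "equiv UNIV (word_cong R)"
proof (rule equivI)
  show "refl (word_cong R)"
    by (rule refl_onI) (rule word_cong.refl)
  show "sym (word_cong R)"
    by (rule symI) (rule word_cong.sym)
  show "trans (word_cong R)"
    by (rule transI) (rule word_cong.trans)
qed simp

lemma mult_presented_group:
  "(word_cong R `` {u}) \<otimes>\<^bsub>presented_group R\<^esub> (word_cong R `` {v}) = word_cong R `` {u @ v}"
proof -
  have eq: "word_cong R `` {x @ y} = word_cong R `` {u @ v}"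
    if "x \<in> word_cong R `` {u}" "y \<in> word_cong R `` {v}" for x y
    using that equiv_class_eq[OF equiv_word_cong word_cong.append[of u x R v y]]
    by (simp add: Image_singleton_iff)
  have mem: "u \<in> word_cong R `` {u}" "v \<in> word_cong R `` {v}"
    by (simp_all add: Image_singleton_iff word_cong.refl)
  have "(\<Union>x\<in>word_cong R `` {u}. \<Union>y\<in>word_cong R `` {v}. word_cong R `` {x @ y}) =
    (\<Union>x\<in>word_cong R `` {u}. \<Union>y\<in>word_cong R `` {v}. word_cong R `` {u @ v})"
    by (intro SUP_cong HOL.refl) (rule eq)
  also have "\<dots> = word_cong R `` {u @ v}"
    using mem by blast
  finally show ?thesis
    by (simp only: presented_group_def monoid.simps)
qed

datatype gen = gen_a | gen_b

definition C4_semidirect_C4 :: "gen word set monoid" where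
  "C4_semidirect_C4 = presented_group
    { (word_pow [Gen gen_a] 4, []),
      (word_pow [Gen gen_b] 4, []),
      (word_comm [Gen gen_a] [Gen gen_b], word_pow [Gen gen_a] 2) }"

definition supp :: "('g \<Rightarrow> 'f::zero) \<Rightarrow> 'g set" where
  "supp x = {g. x g \<noteq> 0}"

text \<open>
  An element \<open>\<Sum>g. x\<^sub>g g\<close> is represented by its coefficient function, which vanishes outside
  \<open>carrier G\<close>. The coefficient field is the type \<open>'f\<close>.
\<close>

definition group_algebra :: "('g, 'm) monoid_scheme \<Rightarrow> ('g \<Rightarrow> 'f::field) ring" where
  "group_algebra G =
    \<lparr> carrier = {x. finite (supp x) \<and> supp x \<subseteq> carrier G},
      monoid.mult = (\<lambda>x y g. \<Sum>h\<in>supp x. \<Sum>k\<in>supp y. if h \<otimes>\<^bsub>G\<^esub> k = g then x h * y k else 0),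
      one = (\<lambda>g. if g = \<one>\<^bsub>G\<^esub> then 1 else 0),
      zero = (\<lambda>g. 0),
      add = (\<lambda>x y g. x g + y g) \<rparr>"

definition augmentation :: "('g \<Rightarrow> 'f::field) \<Rightarrow> 'f" where
  "augmentation x = (\<Sum>g\<in>supp x. x g)"

text \<open>The coefficient of \<open>g\<close> in \<open>\<Sum>h. x\<^sub>h h\<^sup>-\<^sup>1\<close> is the coefficient of \<open>g\<^sup>-\<^sup>1\<close> in \<open>x\<close>.\<close>

definition classical_involution ::
    "('g, 'm) monoid_scheme \<Rightarrow> ('g \<Rightarrow> 'f::field) \<Rightarrow> 'g \<Rightarrow> 'f" where
  "classical_involution G x = (\<lambda>g. if g \<in> carrier G then x (inv\<^bsub>G\<^esub> g) else 0)"

definition normalized_units :: "('g, 'm) monoid_scheme \<Rightarrow> ('g \<Rightarrow> 'f::field) set" where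
  "normalized_units G = {u \<in> Units (group_algebra G). augmentation u = 1}"

definition unitary_normalized_units :: "('g, 'm) monoid_scheme \<Rightarrow> ('g \<Rightarrow> 'f::field) set" where
  "unitary_normalized_units G =
    {u \<in> normalized_units G. classical_involution G u = inv\<^bsub>group_algebra G\<^esub> u}"

definition square_trivial :: "('g, 'm) monoid_scheme \<Rightarrow> 'g set" where
  "square_trivial G = {g \<in> carrier G. g [^]\<^bsub>G\<^esub> (2::nat) = \<one>\<^bsub>G\<^esub>}"

definition elementary_abelian :: "nat \<Rightarrow> ('g, 'm) monoid_scheme \<Rightarrow> bool" where
  "elementary_abelian p E \<longleftrightarrow> comm_group E \<and> (\<forall>x\<in>carrier E. x [^]\<^bsub>E\<^esub> p = \<one>\<^bsub>E\<^esub>)"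

end

theory Submission
  imports Defs "HOL-Library.Numeral_Type" "HOL-Library.Function_Algebras" "HOL-Library.Disjoint_Sets"
begin

text \<open>
  Let \<open>z = a\<^sup>2\<close>, \<open>w = b\<^sup>2\<close> and \<open>Z = \<langle>z, w\<rangle> \<times> E\<close>. Then \<open>Z\<close> is the centre of \<open>G\<close>, it is elementary abelian
  and equals \<open>G\<^sub>T\<close>, and the cosets of \<open>Z\<close> are represented by \<open>1, a, b, ab\<close>. Write
  \<open>u = \<alpha> + \<beta>a + \<gamma>b + \<delta>ab\<close> with coefficients in the commutative ring \<open>FZ\<close>, on which the involution is
  trivial. Then \<open>uu\<^sup>* = 1\<close> says that \<open>u\<close> has augmentation 1, that \<open>\<alpha>\<beta> + \<gamma>\<delta>\<close> is fixed by multiplication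
  with \<open>z\<close>, and that \<open>\<alpha>\<gamma> + z\<beta>\<delta>\<close> and \<open>\<alpha>\<delta> + \<beta>\<gamma>\<close> are fixed by multiplication with \<open>w\<close>. Applying the
  augmentation, exactly one of \<open>\<alpha>, \<beta>, \<gamma>, \<delta>\<close> has augmentation 1 and the others have augmentation 0;
  the four cases are permuted by symmetries, which gives the factor 4. If it is \<open>\<alpha>\<close>, then
  \<open>\<alpha>\<^sup>2 = 1\<close> and \<open>\<beta>\<^sup>2 = \<gamma>\<^sup>2 = \<delta>\<^sup>2 = 0\<close> make \<open>(\<alpha>, \<beta>, \<gamma>, \<delta>)\<close> correspond bijectively to \<open>\<alpha>\<close> together
  with the three fixed elements, so that \<open>|F|\<close> to the power \<open>(|Z| - 1) + 3|Z|/2\<close> solutions arise.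
\<close>

section \<open>The group\<close>

text \<open>These properties survive direct products with elementary abelian 2-groups and
  isomorphisms. So they are verified once, for the presented group, and the count is derived from
  them and characteristic 2. The quaternion group of order 8, with its centre as \<open>Z\<close>,
  has them too, whence the name.\<close>

locale quaternion_like = group G for G (structure) +
  fixes Z and a b
  assumes finite_carrier: "finite (carrier G)"
    and subgroup_Z: "subgroup Z G"
    and central: "k \<in> Z \<Longrightarrow> g \<in> carrier G \<Longrightarrow> g \<otimes> k = k \<otimes> g"
    and square_Z: "k \<in> Z \<Longrightarrow> k \<otimes> k = \<one>"
    and a_carrier: "a \<in> carrier G" and b_carrier: "b \<in> carrier G"
    and a_square: "a \<otimes> a \<in> Z" "a \<otimes> a \<noteq> \<one>"
    and b_square: "b \<otimes> b \<in> Z" "b \<otimes> b \<noteq> \<one>"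
    and b_a: "b \<otimes> a = (a \<otimes> a) \<otimes> (a \<otimes> b)"
    and carrier_subset: "carrier G \<subseteq> (\<Union>k\<in>Z. {k, k \<otimes> a, k \<otimes> b, k \<otimes> (a \<otimes> b)})"
    and not_in_Z: "a \<notin> Z" "b \<notin> Z" "a \<otimes> b \<notin> Z"

section \<open>Stability under direct products and isomorphisms\<close>

lemma quaternion_like_DirProd:
  fixes H (structure)
  assumes "quaternion_like H Z a b" and E: "elementary_abelian 2 E" "finite (carrier E)"
  shows "quaternion_like (H \<times>\<times> E) (Z \<times> carrier E) (a, \<one>\<^bsub>E\<^esub>) (b, \<one>\<^bsub>E\<^esub>)"
proof -
  interpret H: quaternion_like H Z a b by fact
  interpret E: comm_group E using E by (simp add: elementary_abelian_def)
  have sqE: "x \<otimes>\<^bsub>E\<^esub> x = \<one>\<^bsub>E\<^esub>" if "x \<in> carrier E" for x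
    using E(1) that by (simp add: elementary_abelian_def numeral_2_eq_2)
  interpret group "H \<times>\<times> E" by (intro DirProd_group H.is_group E.is_group)
  show ?thesis
  proof (intro quaternion_like.intro quaternion_like_axioms.intro)
    show "finite (carrier (H \<times>\<times> E))" using H.finite_carrier E(2) by simp
    show "subgroup (Z \<times> carrier E) (H \<times>\<times> E)"
      by (intro DirProd_subgroups H.is_group E.is_group H.subgroup_Z E.subgroup_self)
    show "carrier (H \<times>\<times> E) \<subseteq> (\<Union>k\<in>Z \<times> carrier E. {k, k \<otimes>\<^bsub>H \<times>\<times> E\<^esub> (a, \<one>\<^bsub>E\<^esub>),
      k \<otimes>\<^bsub>H \<times>\<times> E\<^esub> (b, \<one>\<^bsub>E\<^esub>), k \<otimes>\<^bsub>H \<times>\<times> E\<^esub> ((a, \<one>\<^bsub>E\<^esub>) \<otimes>\<^bsub>H \<times>\<times> E\<^esub> (b, \<one>\<^bsub>E\<^esub>))})"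
    proof
      fix p assume p: "p \<in> carrier (H \<times>\<times> E)"
      then obtain x y where xy: "p = (x, y)" "x \<in> carrier H" "y \<in> carrier E" by auto
      obtain k where "k \<in> Z" "x \<in> {k, k \<otimes> a, k \<otimes> b, k \<otimes> (a \<otimes> b)}"
        using xy(2) H.carrier_subset by blast
      with xy show "p \<in> (\<Union>k\<in>Z \<times> carrier E. {k, k \<otimes>\<^bsub>H \<times>\<times> E\<^esub> (a, \<one>\<^bsub>E\<^esub>),
          k \<otimes>\<^bsub>H \<times>\<times> E\<^esub> (b, \<one>\<^bsub>E\<^esub>), k \<otimes>\<^bsub>H \<times>\<times> E\<^esub> ((a, \<one>\<^bsub>E\<^esub>) \<otimes>\<^bsub>H \<times>\<times> E\<^esub> (b, \<one>\<^bsub>E\<^esub>))})"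
        by (intro UN_I[of "(k, y)"]) auto
    qed
  qed (use is_group H.central H.square_Z H.a_carrier H.b_carrier H.a_square H.b_square H.b_a H.not_in_Z
      in \<open>auto simp: sqE E.m_comm\<close>)
qed

lemma quaternion_like_iso:
  fixes H (structure)
  assumes "quaternion_like H Z a b" and "group G" and f: "f \<in> iso H G"
  shows "quaternion_like G (f ` Z) (f a) (f b)"
proof -
  interpret H: quaternion_like H Z a b by fact
  interpret G: group G by fact
  interpret f: group_hom H G f
    using f by unfold_locales (simp add: iso_def)
  have bij: "bij_betw f (carrier H) (carrier G)" using f by (simp add: iso_def)
  have inj: "f x = f y \<longleftrightarrow> x = y" if "x \<in> carrier H" "y \<in> carrier H" for x y
    using that bij by (auto simp: bij_betw_def inj_on_eq_iff)
  have Z: "x \<in> carrier H" if "x \<in> Z" for x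
    using that H.subgroup_Z subgroup.subset by blast
  have one: "f x = \<one>\<^bsub>G\<^esub> \<longleftrightarrow> x = \<one>" if "x \<in> carrier H" for x
    using inj[OF that H.one_closed] by simp
  have mem: "f x \<in> f ` Z \<longleftrightarrow> x \<in> Z" if "x \<in> carrier H" for x
    using inj that Z by auto
  note [simp] = H.a_carrier H.b_carrier Z
  note hom = f.hom_mult[symmetric]
  note [simp del] = f.hom_mult
  show ?thesis
  proof (intro quaternion_like.intro quaternion_like_axioms.intro)
    show "finite (carrier G)" using bij H.finite_carrier by (simp add: bij_betw_finite)
    show "subgroup (f ` Z) G" using H.subgroup_Z by (rule f.subgroup_img_is_subgroup)
    show "g \<otimes>\<^bsub>G\<^esub> k = k \<otimes>\<^bsub>G\<^esub> g" if k: "k \<in> f ` Z" and g: "g \<in> carrier G" for k g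
    proof -
      obtain x y where "x \<in> Z" "k = f x" "y \<in> carrier H" "g = f y"
        using k bij_betw_imp_surj_on[OF bij] g[folded bij_betw_imp_surj_on[OF bij]]
        by blast
      then show ?thesis by (simp add: hom H.central)
    qed
    show "k \<otimes>\<^bsub>G\<^esub> k = \<one>\<^bsub>G\<^esub>" if "k \<in> f ` Z" for k
      using that by (auto simp: hom H.square_Z)
    show "carrier G \<subseteq> (\<Union>k\<in>f ` Z. {k, k \<otimes>\<^bsub>G\<^esub> f a, k \<otimes>\<^bsub>G\<^esub> f b, k \<otimes>\<^bsub>G\<^esub> (f a \<otimes>\<^bsub>G\<^esub> f b)})"
    proof
      fix g assume "g \<in> carrier G"
      then obtain x where x: "x \<in> carrier H" "g = f x" using bij by (auto simp: bij_betw_def)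
      then obtain k where "k \<in> Z" "x \<in> {k, k \<otimes> a, k \<otimes> b, k \<otimes> (a \<otimes> b)}"
        using H.carrier_subset by blast
      then show "g \<in> (\<Union>k\<in>f ` Z. {k, k \<otimes>\<^bsub>G\<^esub> f a, k \<otimes>\<^bsub>G\<^esub> f b, k \<otimes>\<^bsub>G\<^esub> (f a \<otimes>\<^bsub>G\<^esub> f b)})"
        using x(2) by (intro UN_I[of "f k"]) (auto simp: hom)
    qed
  qed (use G.is_group H.a_square H.b_square H.b_a H.not_in_Z in \<open>simp_all add: hom inj one mem\<close>)
qed

section \<open>Presented groups and the presentation of \<open>C4_semidirect_C4\<close>\<close>

lemma letter_inv_letter_inv [simp]: "letter_inv (letter_inv l) = l"
  by (cases l) simp_all

lemma word_cong_word_inv: "(word_inv w @ w, []) \<in> word_cong R"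
proof (induction w)
  case Nil
  show ?case by (simp add: word_inv_def word_cong.refl)
next
  case (Cons l w)
  have "([letter_inv l, l], []) \<in> word_cong R"
    using word_cong.cancel[of "letter_inv l" R] by simp
  then have "(word_inv w @ [letter_inv l, l] @ w, word_inv w @ [] @ w) \<in> word_cong R"
    by (intro word_cong.append word_cong.refl)
  with Cons.IH show ?case
    by (auto simp: word_inv_def intro: word_cong.trans)
qed

lemma group_presented_group: "group (presented_group R)"
proof (rule groupI)
  let ?P = "presented_group R"
  have one: "\<one>\<^bsub>?P\<^esub> = word_cong R `` {[]}" and
    carrier: "x \<in> carrier ?P \<longleftrightarrow> (\<exists>w. x = word_cong R `` {w})" for x
    by (auto simp: presented_group_def quotient_def)
  show "\<one>\<^bsub>?P\<^esub> \<in> carrier ?P" by (auto simp: one carrier)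
  show "x \<otimes>\<^bsub>?P\<^esub> y \<in> carrier ?P" if "x \<in> carrier ?P" "y \<in> carrier ?P" for x y
    using that by (auto simp: carrier mult_presented_group)
  show "x \<otimes>\<^bsub>?P\<^esub> y \<otimes>\<^bsub>?P\<^esub> z = x \<otimes>\<^bsub>?P\<^esub> (y \<otimes>\<^bsub>?P\<^esub> z)"
    if "x \<in> carrier ?P" "y \<in> carrier ?P" "z \<in> carrier ?P" for x y z
    using that by (auto simp: carrier mult_presented_group)
  show "\<one>\<^bsub>?P\<^esub> \<otimes>\<^bsub>?P\<^esub> x = x" if "x \<in> carrier ?P" for x
    using that by (auto simp: carrier one mult_presented_group)
  show "\<exists>y\<in>carrier ?P. y \<otimes>\<^bsub>?P\<^esub> x = \<one>\<^bsub>?P\<^esub>" if x: "x \<in> carrier ?P" for x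
  proof -
    obtain w where w: "x = word_cong R `` {w}" using x by (auto simp: carrier)
    have "word_cong R `` {word_inv w @ w} = word_cong R `` {[]}"
      by (rule equiv_class_eq[OF equiv_word_cong word_cong_word_inv])
    then show ?thesis
      by (intro bexI[of _ "word_cong R `` {word_inv w}"])
        (auto simp: w one carrier mult_presented_group)
  qed
qed

text \<open>The pair \<open>(i, j)\<close> stands for \<open>a\<^sup>i b\<^sup>j\<close>, and the
  type \<open>4\<close> for the integers modulo 4. The sign changes come from
  \<open>b a = a\<^sup>-\<^sup>1 b\<close>: moving a power of \<open>b\<close> with odd exponent
  past \<open>a\<^sup>i\<close> inverts it.\<close>

fun act :: "gen letter \<Rightarrow> 4 \<times> 4 \<Rightarrow> 4 \<times> 4" where
  "act (Gen gen_a) (i, j) = (i + 1, j)"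
| "act (GenInv gen_a) (i, j) = (i - 1, j)"
| "act (Gen gen_b) (i, j) = (- i, j + 1)"
| "act (GenInv gen_b) (i, j) = (- i, j - 1)"

definition C4_rels :: "(gen word \<times> gen word) set" where
  "C4_rels = { (word_pow [Gen gen_a] 4, []), (word_pow [Gen gen_b] 4, []),
      (word_comm [Gen gen_a] [Gen gen_b], word_pow [Gen gen_a] 2) }"

lemma C4_semidirect_C4_eq: "C4_semidirect_C4 = presented_group C4_rels"
  by (simp add: C4_semidirect_C4_def C4_rels_def)

text \<open>
  Left multiplication on the normal forms \<open>a\<^sup>i b\<^sup>j\<close>, with exponents modulo 4, respects the
  relations. This is what keeps the presented group from collapsing.
\<close>

lemma act_word_cong: "(u, v) \<in> word_cong C4_rels \<Longrightarrow> foldr act u p = foldr act v p"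
proof (induction arbitrary: p rule: word_cong.induct)
  case (relation u v)
  obtain i j where p: "p = (i, j)" by (cases p)
  \<comment> \<open>The commutator word sends \<open>(i, j)\<close> to \<open>(i - 2, j)\<close>,
    whereas the square of \<open>a\<close> sends it to \<open>(i + 2, j)\<close>; modulo 4 these
    agree.\<close>
  have "i - 2 = i + 2"
    using add_left_cancel[of i "-2" 2] by simp
  with relation show ?case
    by (auto simp: p C4_rels_def word_pow_def word_comm_def word_inv_def numeral_eq_Suc
        algebra_simps)
next
  case (cancel l)
  obtain i j where p: "p = (i, j)" by (cases p)
  obtain g where "l = Gen g \<or> l = GenInv g" by (cases l) auto
  then show ?case by (cases g) (auto simp: p)
qed auto

text \<open>Two halves. The relations bound the group from above: every element is some
  \<open>k y\<close> with \<open>k\<close> in \<open>{1, z, w, z w}\<close> and \<open>y\<close> in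
  \<open>{1, a, b, a b}\<close>. The action on normal forms bounds it from below: \<open>z\<close>
  and \<open>w\<close> are not 1, and \<open>a\<close>, \<open>b\<close>, \<open>a b\<close> lie
  outside \<open>Z\<close>.\<close>

lemma quaternion_like_C4_semidirect_C4:
  "\<exists>Z a b. quaternion_like C4_semidirect_C4 Z a b"
proof -
  define H where "H = C4_semidirect_C4"
  define cls where "cls w = word_cong C4_rels `` {w}" for w
  interpret group H
    unfolding H_def C4_semidirect_C4_eq by (rule group_presented_group)
  have cls_mult: "cls u \<otimes>\<^bsub>H\<^esub> cls v = cls (u @ v)" for u v
    by (simp add: H_def C4_semidirect_C4_eq cls_def mult_presented_group)
  have cls_carrier [simp]: "cls u \<in> carrier H" for u
    by (auto simp: H_def C4_semidirect_C4_eq cls_def presented_group_def quotient_def)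
  have carrierD: "\<exists>w. x = cls w" if "x \<in> carrier H" for x
    using that by (auto simp: H_def C4_semidirect_C4_eq cls_def presented_group_def quotient_def)
  have one: "\<one>\<^bsub>H\<^esub> = cls []"
    by (simp add: H_def C4_semidirect_C4_eq cls_def presented_group_def)
  \<comment> \<open>Used in contraposition for \<open>neq\<close>: two words are different in the
    group if they move the normal form \<open>(0, 0)\<close> to different places.\<close>
  have cls_act: "foldr act u (0, 0) = foldr act v (0, 0)" if "cls u = cls v" for u v
    using that eq_equiv_class[OF _ equiv_word_cong, of C4_rels u v] act_word_cong
    by (auto simp: cls_def)
  have cls_rel: "cls u = cls v" if "(u, v) \<in> C4_rels" for u v
    unfolding cls_def
    by (rule equiv_class_eq[OF equiv_word_cong word_cong.relation[OF that]])
  define a b where "a = cls [Gen gen_a]" and "b = cls [Gen gen_b]"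
  define z w where "z = a \<otimes>\<^bsub>H\<^esub> a" and "w = b \<otimes>\<^bsub>H\<^esub> b"
  define Z where "Z = {\<one>\<^bsub>H\<^esub>, z, w, z \<otimes>\<^bsub>H\<^esub> w}"
  note m_assoc [simp]
  have ab [simp]: "a \<in> carrier H" "b \<in> carrier H" by (simp_all add: a_def b_def)
  have inv_cls: "cls [GenInv g] = inv\<^bsub>H\<^esub> (cls [Gen g])" for g
  proof (rule inv_equality[symmetric])
    show "cls [GenInv g] \<otimes>\<^bsub>H\<^esub> cls [Gen g] = \<one>\<^bsub>H\<^esub>"
      using word_cong.cancel[of "GenInv g" C4_rels]
      by (simp add: cls_mult one) (simp add: cls_def equiv_class_eq[OF equiv_word_cong])
  qed simp_all
  have zz: "z \<otimes>\<^bsub>H\<^esub> z = \<one>\<^bsub>H\<^esub>"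
    using cls_rel[of "word_pow [Gen gen_a] 4" "[]"]
    by (simp add: C4_rels_def z_def a_def cls_mult one word_pow_def numeral_eq_Suc)
  have ww: "w \<otimes>\<^bsub>H\<^esub> w = \<one>\<^bsub>H\<^esub>"
    using cls_rel[of "word_pow [Gen gen_b] 4" "[]"]
    by (simp add: C4_rels_def w_def b_def cls_mult one word_pow_def numeral_eq_Suc)
  have zw [simp]: "z \<in> carrier H" "w \<in> carrier H" by (simp_all add: z_def w_def)
  have "inv\<^bsub>H\<^esub> a \<otimes>\<^bsub>H\<^esub> (inv\<^bsub>H\<^esub> b \<otimes>\<^bsub>H\<^esub> (a \<otimes>\<^bsub>H\<^esub> b)) = z"
    using cls_rel[of "word_comm [Gen gen_a] [Gen gen_b]" "word_pow [Gen gen_a] 2"]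
    by (simp add: C4_rels_def z_def a_def b_def flip: inv_cls)
      (simp add: cls_mult word_pow_def word_comm_def word_inv_def numeral_eq_Suc)
  then have a_b: "a \<otimes>\<^bsub>H\<^esub> b = b \<otimes>\<^bsub>H\<^esub> (a \<otimes>\<^bsub>H\<^esub> z)"
    by (metis ab(1) ab(2) inv_closed inv_solve_left m_closed zw(1))
  have az: "a \<otimes>\<^bsub>H\<^esub> z = z \<otimes>\<^bsub>H\<^esub> a" by (simp add: z_def)
  have bw: "b \<otimes>\<^bsub>H\<^esub> w = w \<otimes>\<^bsub>H\<^esub> b" by (simp add: w_def)
  \<comment> \<open>Moving \<open>b\<close> past \<open>a\<close> costs a factor \<open>z\<close>.
    Passing both factors of \<open>z = a a\<close> costs \<open>z z = 1\<close>, so \<open>b\<close>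
    commutes with \<open>z\<close>. For \<open>aw\<close> below, \<open>a\<close> passes both
    factors of \<open>w = b b\<close> in the same way.\<close>
  have bz: "b \<otimes>\<^bsub>H\<^esub> z = z \<otimes>\<^bsub>H\<^esub> b"
  proof -
    have "z \<otimes>\<^bsub>H\<^esub> b = a \<otimes>\<^bsub>H\<^esub> (b \<otimes>\<^bsub>H\<^esub> (a \<otimes>\<^bsub>H\<^esub> z))"
      by (simp only: a_b[symmetric]) (simp add: z_def)
    also have "\<dots> = (a \<otimes>\<^bsub>H\<^esub> b) \<otimes>\<^bsub>H\<^esub> (a \<otimes>\<^bsub>H\<^esub> z)" by simp
    also have "\<dots> = b \<otimes>\<^bsub>H\<^esub> (a \<otimes>\<^bsub>H\<^esub> (z \<otimes>\<^bsub>H\<^esub> (z \<otimes>\<^bsub>H\<^esub> a)))"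
      by (simp add: a_b) (simp add: az)
    also have "z \<otimes>\<^bsub>H\<^esub> (z \<otimes>\<^bsub>H\<^esub> a) = a" using zz by (simp flip: m_assoc)
    finally show ?thesis by (simp add: z_def)
  qed
  have ba: "b \<otimes>\<^bsub>H\<^esub> a = z \<otimes>\<^bsub>H\<^esub> (a \<otimes>\<^bsub>H\<^esub> b)"
  proof -
    have "z \<otimes>\<^bsub>H\<^esub> (a \<otimes>\<^bsub>H\<^esub> b) = (z \<otimes>\<^bsub>H\<^esub> b) \<otimes>\<^bsub>H\<^esub> (a \<otimes>\<^bsub>H\<^esub> z)" by (simp add: a_b)
    also have "\<dots> = b \<otimes>\<^bsub>H\<^esub> (z \<otimes>\<^bsub>H\<^esub> (z \<otimes>\<^bsub>H\<^esub> a))" by (simp add: az flip: bz)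
    also have "z \<otimes>\<^bsub>H\<^esub> (z \<otimes>\<^bsub>H\<^esub> a) = a" using zz by (simp flip: m_assoc)
    finally show ?thesis ..
  qed
  have aw: "a \<otimes>\<^bsub>H\<^esub> w = w \<otimes>\<^bsub>H\<^esub> a"
  proof -
    have "w \<otimes>\<^bsub>H\<^esub> a = b \<otimes>\<^bsub>H\<^esub> (b \<otimes>\<^bsub>H\<^esub> a)" by (simp add: w_def)
    also have "\<dots> = (b \<otimes>\<^bsub>H\<^esub> z) \<otimes>\<^bsub>H\<^esub> (a \<otimes>\<^bsub>H\<^esub> b)" by (simp add: ba)
    also have "\<dots> = z \<otimes>\<^bsub>H\<^esub> ((b \<otimes>\<^bsub>H\<^esub> a) \<otimes>\<^bsub>H\<^esub> b)" by (simp add: bz)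
    also have "\<dots> = (z \<otimes>\<^bsub>H\<^esub> z) \<otimes>\<^bsub>H\<^esub> (a \<otimes>\<^bsub>H\<^esub> (b \<otimes>\<^bsub>H\<^esub> b))" by (simp add: ba)
    finally show ?thesis by (simp add: zz w_def)
  qed
  have wz: "w \<otimes>\<^bsub>H\<^esub> z = z \<otimes>\<^bsub>H\<^esub> w"
    by (metis aw m_assoc z_def ab(1) zw(2))
  have lc: "y \<otimes>\<^bsub>H\<^esub> (x \<otimes>\<^bsub>H\<^esub> v) = x \<otimes>\<^bsub>H\<^esub> (y \<otimes>\<^bsub>H\<^esub> v)"
    if "y \<otimes>\<^bsub>H\<^esub> x = x \<otimes>\<^bsub>H\<^esub> y" "x \<in> carrier H" "y \<in> carrier H" "v \<in> carrier H" for x y v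
    using that by (simp flip: m_assoc)
  note comm = az bz aw bw wz lc[OF az] lc[OF bz] lc[OF aw] lc[OF bw] lc[OF wz]
  have zz': "z \<otimes>\<^bsub>H\<^esub> (z \<otimes>\<^bsub>H\<^esub> x) = x" "w \<otimes>\<^bsub>H\<^esub> (w \<otimes>\<^bsub>H\<^esub> x) = x" if "x \<in> carrier H" for x
    using that zz ww by (simp_all flip: m_assoc)
  have aa: "a \<otimes>\<^bsub>H\<^esub> a = z" "b \<otimes>\<^bsub>H\<^esub> b = w" by (simp_all add: z_def w_def)
  have aa': "a \<otimes>\<^bsub>H\<^esub> (a \<otimes>\<^bsub>H\<^esub> x) = z \<otimes>\<^bsub>H\<^esub> x" "b \<otimes>\<^bsub>H\<^esub> (b \<otimes>\<^bsub>H\<^esub> x) = w \<otimes>\<^bsub>H\<^esub> x"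
      "b \<otimes>\<^bsub>H\<^esub> (a \<otimes>\<^bsub>H\<^esub> x) = z \<otimes>\<^bsub>H\<^esub> (a \<otimes>\<^bsub>H\<^esub> (b \<otimes>\<^bsub>H\<^esub> x))" if "x \<in> carrier H" for x
    using that ba by (simp_all add: z_def w_def flip: m_assoc)
  note rew = comm zz' zz ww aa aa' ba
  have inv_ab: "inv\<^bsub>H\<^esub> a = z \<otimes>\<^bsub>H\<^esub> a" "inv\<^bsub>H\<^esub> b = w \<otimes>\<^bsub>H\<^esub> b"
    by (rule inv_equality; simp add: rew)+
  have Z_carrier [simp]: "k \<in> carrier H" if "k \<in> Z" for k
    using that by (auto simp: Z_def)
  have Z_mult: "k \<otimes>\<^bsub>H\<^esub> l \<in> Z" if "k \<in> Z" "l \<in> Z" for k l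
    using that by (auto simp: Z_def rew)
  have Z_z: "\<one>\<^bsub>H\<^esub> \<in> Z" "z \<in> Z" "w \<in> Z" by (simp_all add: Z_def)
  have Z_comm: "a \<otimes>\<^bsub>H\<^esub> k = k \<otimes>\<^bsub>H\<^esub> a" "b \<otimes>\<^bsub>H\<^esub> k = k \<otimes>\<^bsub>H\<^esub> b" if "k \<in> Z" for k
    using that by (auto simp: Z_def rew)
  define Y where "Y = {\<one>\<^bsub>H\<^esub>, a, b, a \<otimes>\<^bsub>H\<^esub> b}"
  \<comment> \<open>The elements in normal form. This set contains 1 and is closed under left
    multiplication by \<open>Z\<close>, \<open>a\<close> and \<open>b\<close>, hence also by the
    inverses \<open>z a\<close> and \<open>w b\<close>; by induction on words it is the whole
    carrier.\<close>
  define S where "S = {k \<otimes>\<^bsub>H\<^esub> y | k y. k \<in> Z \<and> y \<in> Y}"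
  have Y_carrier [simp]: "y \<in> carrier H" if "y \<in> Y" for y
    using that by (auto simp: Y_def)
  have S_I: "k \<otimes>\<^bsub>H\<^esub> y \<in> S" if "k \<in> Z" "y \<in> Y" for k y
    using that by (auto simp: S_def)
  have S_Z: "k \<otimes>\<^bsub>H\<^esub> x \<in> S" if k: "k \<in> Z" and x: "x \<in> S" for k x
  proof -
    obtain l y where "l \<in> Z" "y \<in> Y" "x = l \<otimes>\<^bsub>H\<^esub> y" using x by (auto simp: S_def)
    then show ?thesis using S_I[of "k \<otimes>\<^bsub>H\<^esub> l" y] k by (simp add: Z_mult)
  qed
  have gen_S: "g \<otimes>\<^bsub>H\<^esub> x \<in> S" if g: "g = a \<or> g = b" and x: "x \<in> S" for g x
  proof -
    obtain k y where k: "k \<in> Z" and y: "y \<in> Y" and x: "x = k \<otimes>\<^bsub>H\<^esub> y"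
      using x by (auto simp: S_def)
    \<comment> \<open>The eight products of a generator with a representative in \<open>Y\<close>,
      each written as an element of \<open>Z\<close> times one of \<open>Y\<close>; the last one is
      \<open>b (a b) = (z w) a\<close>.\<close>
    have "g \<otimes>\<^bsub>H\<^esub> y \<in> {\<one>\<^bsub>H\<^esub> \<otimes>\<^bsub>H\<^esub> a, \<one>\<^bsub>H\<^esub> \<otimes>\<^bsub>H\<^esub> b, z \<otimes>\<^bsub>H\<^esub> \<one>\<^bsub>H\<^esub>, w \<otimes>\<^bsub>H\<^esub> \<one>\<^bsub>H\<^esub>,
        \<one>\<^bsub>H\<^esub> \<otimes>\<^bsub>H\<^esub> (a \<otimes>\<^bsub>H\<^esub> b), z \<otimes>\<^bsub>H\<^esub> (a \<otimes>\<^bsub>H\<^esub> b), z \<otimes>\<^bsub>H\<^esub> b, (z \<otimes>\<^bsub>H\<^esub> w) \<otimes>\<^bsub>H\<^esub> a}"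
      using g y unfolding Y_def by (elim disjE insertE emptyE) (simp_all add: rew)
    then have "g \<otimes>\<^bsub>H\<^esub> y \<in> S"
      by (elim insertE emptyE; simp only:; intro S_I) (simp_all add: Y_def Z_def)
    moreover have "g \<otimes>\<^bsub>H\<^esub> x = k \<otimes>\<^bsub>H\<^esub> (g \<otimes>\<^bsub>H\<^esub> y)"
      unfolding x using g k y lc[OF Z_comm(1)[OF k]] lc[OF Z_comm(2)[OF k]] by auto
    ultimately show ?thesis using S_Z[OF k] by simp
  qed
  have cls_S: "cls u \<in> S" for u
  proof (induction u)
    case Nil
    show ?case using S_I[of "\<one>\<^bsub>H\<^esub>" "\<one>\<^bsub>H\<^esub>"] by (simp add: Y_def Z_def flip: one)
  next
    case (Cons l u)
    have cons: "cls (l # u) = cls [l] \<otimes>\<^bsub>H\<^esub> cls u" by (simp add: cls_mult)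
    have "cls [l] \<otimes>\<^bsub>H\<^esub> cls u \<in> {a \<otimes>\<^bsub>H\<^esub> cls u, b \<otimes>\<^bsub>H\<^esub> cls u, z \<otimes>\<^bsub>H\<^esub> (a \<otimes>\<^bsub>H\<^esub> cls u), w \<otimes>\<^bsub>H\<^esub> (b \<otimes>\<^bsub>H\<^esub> cls u)}"
    proof (cases l)
      case (Gen g)
      then show ?thesis by (cases g) (simp_all add: a_def b_def)
    next
      case (GenInv g)
      then show ?thesis by (cases g) (simp_all add: inv_cls inv_ab flip: a_def b_def)
    qed
    then show ?case
      unfolding cons by (elim insertE emptyE) (simp_all only: gen_S S_Z Z_z Cons.IH simp_thms)
  qed
  have carrier_S: "x \<in> S" if "x \<in> carrier H" for x
    using carrierD[OF that] cls_S by auto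
  have fin: "finite (carrier H)"
  proof (rule finite_subset)
    show "carrier H \<subseteq> (\<lambda>(k, y). k \<otimes>\<^bsub>H\<^esub> y) ` (Z \<times> Y)"
      using carrier_S by (fastforce simp: S_def)
  qed (simp add: Z_def Y_def)
  have neq: "a \<notin> Z" "b \<notin> Z" "a \<otimes>\<^bsub>H\<^esub> b \<notin> Z" "z \<noteq> \<one>\<^bsub>H\<^esub>" "w \<noteq> \<one>\<^bsub>H\<^esub>"
    unfolding Z_def z_def w_def a_def b_def one cls_mult by (auto dest!: cls_act)
  have sub: "subgroup Z H"
  proof (rule subgroupI)
    show "inv\<^bsub>H\<^esub> x \<in> Z" if "x \<in> Z" for x
    proof -
      have "inv\<^bsub>H\<^esub> x = x" using that by (intro inv_equality) (auto simp: Z_def rew)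
      with that show ?thesis by simp
    qed
  qed (auto simp: Z_def rew)
  have cent: "g \<otimes>\<^bsub>H\<^esub> k = k \<otimes>\<^bsub>H\<^esub> g" if k: "k \<in> Z" and g: "g \<in> carrier H" for k g
  proof -
    obtain l y where l: "l \<in> Z" and y: "y \<in> Y" and gl: "g = l \<otimes>\<^bsub>H\<^esub> y"
      using carrier_S[OF g] by (auto simp: S_def)
    have yk: "y \<otimes>\<^bsub>H\<^esub> k = k \<otimes>\<^bsub>H\<^esub> y"
      using y k lc[OF Z_comm(1)[OF k]] by (auto simp: Y_def Z_comm)
    have "l \<otimes>\<^bsub>H\<^esub> k = k \<otimes>\<^bsub>H\<^esub> l"
      using l k by (auto simp: Z_def rew)
    from lc[OF this] k l y show ?thesis by (simp add: gl yk)
  qed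
  have "quaternion_like H Z a b"
  proof (intro quaternion_like.intro quaternion_like_axioms.intro)
    show "carrier H \<subseteq> (\<Union>k\<in>Z. {k, k \<otimes>\<^bsub>H\<^esub> a, k \<otimes>\<^bsub>H\<^esub> b, k \<otimes>\<^bsub>H\<^esub> (a \<otimes>\<^bsub>H\<^esub> b)})"
    proof
      fix x assume "x \<in> carrier H"
      then obtain k y where "k \<in> Z" "y \<in> Y" "x = k \<otimes>\<^bsub>H\<^esub> y"
        using carrier_S[of x] by (auto simp: S_def)
      then show "x \<in> (\<Union>k\<in>Z. {k, k \<otimes>\<^bsub>H\<^esub> a, k \<otimes>\<^bsub>H\<^esub> b, k \<otimes>\<^bsub>H\<^esub> (a \<otimes>\<^bsub>H\<^esub> b)})"
        by (intro UN_I[of k]) (auto simp: Y_def)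
    qed
    show "k \<otimes>\<^bsub>H\<^esub> k = \<one>\<^bsub>H\<^esub>" if "k \<in> Z" for k using that by (auto simp: Z_def rew)
  qed (simp_all add: is_group sub cent fin neq Z_z aa ba)
  then show ?thesis unfolding H_def by blast
qed

section \<open>Convolution over the centre\<close>

context quaternion_like
begin

section \<open>Normal forms and the cosets of \<open>Z\<close>\<close>

definition z where "z = a \<otimes> a"
definition w where "w = b \<otimes> b"
definition Y where "Y = {\<one>, a, b, a \<otimes> b}"

lemma Z_carrier [simp]: "k \<in> Z \<Longrightarrow> k \<in> carrier G"
  using subgroup_Z subgroup.subset by blast

lemma finite_Z: "finite Z"
  by (rule finite_subset[OF _ finite_carrier]) (auto simp: Z_carrier)

lemma Z_closed [simp]: "\<one> \<in> Z" "k \<in> Z \<Longrightarrow> l \<in> Z \<Longrightarrow> k \<otimes> l \<in> Z" "z \<in> Z" "w \<in> Z"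
  using subgroup_Z a_square b_square by (simp_all add: subgroup_def z_def w_def)

lemma z_neq: "z \<noteq> \<one>" "w \<noteq> \<one>"
  using a_square b_square by (simp_all add: z_def w_def)

lemma ab_carrier [simp]: "a \<in> carrier G" "b \<in> carrier G"
  by (fact a_carrier b_carrier)+

lemma Y_carrier [simp]: "y \<in> Y \<Longrightarrow> y \<in> carrier G"
  by (auto simp: Y_def)

lemma Z_square' [simp]: "k \<in> Z \<Longrightarrow> x \<in> carrier G \<Longrightarrow> k \<otimes> (k \<otimes> x) = x"
  by (simp add: square_Z flip: m_assoc)

declare square_Z [simp]

lemma Z_comm: "k \<in> Z \<Longrightarrow> l \<in> Z \<Longrightarrow> k \<otimes> l = l \<otimes> k"
  by (rule central) simp_all

lemma central_left: "k \<in> Z \<Longrightarrow> x \<in> carrier G \<Longrightarrow> y \<in> carrier G \<Longrightarrow> x \<otimes> (k \<otimes> y) = k \<otimes> (x \<otimes> y)"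
  using central[of k x] by (simp flip: m_assoc)

lemma Z_left_comm: "k \<in> Z \<Longrightarrow> l \<in> Z \<Longrightarrow> y \<in> carrier G \<Longrightarrow> l \<otimes> (k \<otimes> y) = k \<otimes> (l \<otimes> y)"
  by (rule central_left) simp_all

text \<open>Read from left to right, these are rewrite rules that collect central factors in front,
  put \<open>a\<close> before \<open>b\<close> and replace squares of \<open>a\<close> and
  \<open>b\<close> by \<open>z\<close> and \<open>w\<close>.\<close>

lemma ab_normal_form:
  "a \<otimes> a = z" "b \<otimes> b = w" "b \<otimes> a = z \<otimes> (a \<otimes> b)"
  "x \<in> carrier G \<Longrightarrow> a \<otimes> (a \<otimes> x) = z \<otimes> x"
  "x \<in> carrier G \<Longrightarrow> b \<otimes> (b \<otimes> x) = w \<otimes> x"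
  "x \<in> carrier G \<Longrightarrow> b \<otimes> (a \<otimes> x) = z \<otimes> (a \<otimes> (b \<otimes> x))"
  "k \<in> Z \<Longrightarrow> a \<otimes> k = k \<otimes> a" "k \<in> Z \<Longrightarrow> b \<otimes> k = k \<otimes> b"
  "k \<in> Z \<Longrightarrow> x \<in> carrier G \<Longrightarrow> a \<otimes> (k \<otimes> x) = k \<otimes> (a \<otimes> x)"
  "k \<in> Z \<Longrightarrow> x \<in> carrier G \<Longrightarrow> b \<otimes> (k \<otimes> x) = k \<otimes> (b \<otimes> x)"
proof -
  show ba: "b \<otimes> a = z \<otimes> (a \<otimes> b)" using b_a by (simp add: z_def)
  show "x \<in> carrier G \<Longrightarrow> a \<otimes> (a \<otimes> x) = z \<otimes> x" "x \<in> carrier G \<Longrightarrow> b \<otimes> (b \<otimes> x) = w \<otimes> x"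
    by (simp_all add: z_def w_def m_assoc)
  show "b \<otimes> (a \<otimes> x) = z \<otimes> (a \<otimes> (b \<otimes> x))" if "x \<in> carrier G"
  proof -
    have "b \<otimes> (a \<otimes> x) = (b \<otimes> a) \<otimes> x" using that by (simp add: m_assoc)
    also have "\<dots> = z \<otimes> (a \<otimes> (b \<otimes> x))" using that by (simp only: ba) (simp add: m_assoc)
    finally show ?thesis .
  qed
  show "a \<otimes> k = k \<otimes> a" "b \<otimes> k = k \<otimes> b" if "k \<in> Z" using that by (auto intro: central)
  show "a \<otimes> (k \<otimes> x) = k \<otimes> (a \<otimes> x)" "b \<otimes> (k \<otimes> x) = k \<otimes> (b \<otimes> x)" if "k \<in> Z" "x \<in> carrier G"
    using that by (auto intro: central_left)
qed (simp_all add: z_def w_def)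

lemmas normal_form = m_assoc ab_normal_form Z_comm Z_left_comm

text \<open>Any coincidence between different cosets would put \<open>a\<close>, \<open>b\<close> or
  \<open>a b\<close> into \<open>Z\<close>. If \<open>a = k b\<close>, multiplying by
  \<open>a\<close> gives \<open>z = k (a b)\<close>, so \<open>a b = k z\<close>; if
  \<open>k a = a b\<close> or \<open>k b = a b\<close>, cancelling leaves \<open>b = k\<close> or
  \<open>a = k\<close>. The mirrored cases follow because \<open>k\<close> is its own
  inverse.\<close>

lemma Y_inj:
  assumes "x \<in> Y" "y \<in> Y" "l \<in> Z" "x = l \<otimes> y"
  shows "x = y"
proof -
  have no: "k \<otimes> a \<noteq> \<one>" "k \<otimes> b \<noteq> \<one>" "k \<otimes> (a \<otimes> b) \<noteq> \<one>" if k: "k \<in> Z" for k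
  proof -
    have "k \<otimes> x \<noteq> \<one>" if x: "x \<in> carrier G" "x \<notin> Z" for x
    proof
      assume "k \<otimes> x = \<one>"
      then have "k \<otimes> (k \<otimes> x) = k" using k by simp
      with k x show False by simp
    qed
    with not_in_Z show "k \<otimes> a \<noteq> \<one>" "k \<otimes> b \<noteq> \<one>" "k \<otimes> (a \<otimes> b) \<noteq> \<one>" by simp_all
  qed
  have ab: False if "a = k \<otimes> b" "k \<in> Z" for k
  proof -
    have "z = a \<otimes> (k \<otimes> b)" unfolding z_def by (rule arg_cong[OF that(1)])
    then have "k \<otimes> z = k \<otimes> (k \<otimes> (a \<otimes> b))" by (simp only: ab_normal_form that(2) ab_carrier)
    then have "a \<otimes> b = k \<otimes> z" using that(2) by simp
    with not_in_Z that(2) show False by simp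
  qed
  have aab: False if "k \<otimes> a = a \<otimes> b" "k \<in> Z" for k
  proof -
    have "a \<otimes> k = a \<otimes> b" using that by (simp add: ab_normal_form)
    with that not_in_Z show False by simp
  qed
  have bab: False if "k \<otimes> b = a \<otimes> b" "k \<in> Z" for k
    using that not_in_Z by simp
  have swap: "k \<otimes> u = v" if "u = k \<otimes> v" "k \<in> Z" "v \<in> carrier G" for k u v
    using that by simp
  have no': "\<one> \<noteq> k \<otimes> a" "\<one> \<noteq> k \<otimes> b" "\<one> \<noteq> k \<otimes> (a \<otimes> b)" "a \<noteq> k" "b \<noteq> k" "a \<otimes> b \<noteq> k"
    "a \<noteq> k \<otimes> b" "b \<noteq> k \<otimes> a" "a \<noteq> k \<otimes> (a \<otimes> b)" "b \<noteq> k \<otimes> (a \<otimes> b)"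
    "a \<otimes> b \<noteq> k \<otimes> a" "a \<otimes> b \<noteq> k \<otimes> b" if k: "k \<in> Z" for k
    using no[OF k] not_in_Z k ab[of k] aab[of k] bab[of k]
      swap[of b k a] swap[of a k "a \<otimes> b"] swap[of b k "a \<otimes> b"]
    by (metis ab_carrier m_closed)+
  show ?thesis
    using assms(1,2,4) unfolding Y_def
    by (elim insertE emptyE) (simp_all add: no' assms(3))
qed

lemma bij_betw_carrier: "bij_betw (\<lambda>(k, y). k \<otimes> y) (Z \<times> Y) (carrier G)"
  unfolding bij_betw_def
proof
  show "inj_on (\<lambda>(k, y). k \<otimes> y) (Z \<times> Y)"
  proof (rule inj_onI, clarsimp)
    fix k y l x assume kl: "k \<in> Z" "l \<in> Z" and xy: "y \<in> Y" "x \<in> Y" and eq: "k \<otimes> y = l \<otimes> x"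
    have "k \<otimes> (k \<otimes> y) = (k \<otimes> l) \<otimes> x" using kl xy eq by (simp add: m_assoc)
    with Y_inj[OF xy(1,2), of "k \<otimes> l"] kl xy have "y = x" by simp
    with eq kl xy show "k = l \<and> y = x" by simp
  qed
  show "(\<lambda>(k, y). k \<otimes> y) ` (Z \<times> Y) = carrier G"
  proof
    show "carrier G \<subseteq> (\<lambda>(k, y). k \<otimes> y) ` (Z \<times> Y)"
    proof
      fix g assume "g \<in> carrier G"
      then obtain k where "k \<in> Z" "g \<in> {k, k \<otimes> a, k \<otimes> b, k \<otimes> (a \<otimes> b)}"
        using carrier_subset by blast
      then have "\<exists>y\<in>Y. g = k \<otimes> y" by (auto simp: Y_def)
      with \<open>k \<in> Z\<close> show "g \<in> (\<lambda>(k, y). k \<otimes> y) ` (Z \<times> Y)" by force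
    qed
  qed auto
qed

lemma Y_distinct: "a \<noteq> \<one>" "b \<noteq> \<one>" "a \<otimes> b \<noteq> \<one>" "a \<noteq> b" "a \<noteq> a \<otimes> b" "b \<noteq> a \<otimes> b"
proof -
  show "a \<noteq> b"
  proof
    assume eq: "a = b"
    have "a \<otimes> b = w" unfolding w_def by (simp only: eq)
    with not_in_Z show False by simp
  qed
  show "a \<noteq> a \<otimes> b"
    using not_in_Z Z_closed(1) l_cancel_one[of a b] by (metis ab_carrier)
  show "b \<noteq> a \<otimes> b"
    using not_in_Z Z_closed(1) r_cancel_one[of b a] by (metis ab_carrier)
qed (use not_in_Z in auto)

lemma sum_carrier:
  fixes f :: "_ \<Rightarrow> 'c::comm_monoid_add"
  shows "(\<Sum>h\<in>carrier G. f h) = (\<Sum>k\<in>Z. f k + f (k \<otimes> a) + f (k \<otimes> b) + f (k \<otimes> (a \<otimes> b)))"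
proof -
  have "(\<Sum>h\<in>carrier G. f h) = (\<Sum>(k, y)\<in>Z \<times> Y. f (k \<otimes> y))"
    by (subst sum.reindex_bij_betw[OF bij_betw_carrier, symmetric]) (simp add: split_def)
  also have "\<dots> = (\<Sum>k\<in>Z. \<Sum>y\<in>Y. f (k \<otimes> y))"
    by (simp add: sum.cartesian_product)
  also have "\<dots> = (\<Sum>k\<in>Z. f k + f (k \<otimes> a) + f (k \<otimes> b) + f (k \<otimes> (a \<otimes> b)))"
  proof (rule sum.cong)
    fix k assume "k \<in> Z"
    have "sum g Y = g \<one> + g a + g b + g (a \<otimes> b)" for g :: "_ \<Rightarrow> 'c"
      unfolding Y_def using Y_distinct Y_distinct[symmetric] by (simp add: add.assoc)
    from this[of "\<lambda>y. f (k \<otimes> y)"] \<open>k \<in> Z\<close>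
    show "(\<Sum>y\<in>Y. f (k \<otimes> y)) = f k + f (k \<otimes> a) + f (k \<otimes> b) + f (k \<otimes> (a \<otimes> b))" by simp
  qed simp
  finally show ?thesis .
qed

lemma order_eq: "order G = 4 * card Z"
proof -
  have "card Y = 4" using Y_distinct by (simp add: Y_def)
  then show ?thesis
    using bij_betw_same_card[OF bij_betw_carrier] by (simp add: order_def card_cartesian_product)
qed

text \<open>Outside \<open>Z\<close> no square is trivial: \<open>k a\<close> has square
  \<open>z\<close>, while \<open>k b\<close> and \<open>k (a b)\<close> both have square
  \<open>w\<close>.\<close>

lemma square_trivial_eq: "square_trivial G = Z"
proof -
  have "g \<in> Z" if g: "g \<in> carrier G" and sq: "g \<otimes> g = \<one>" for g
  proof -
    obtain k where k: "k \<in> Z" "g \<in> {k, k \<otimes> a, k \<otimes> b, k \<otimes> (a \<otimes> b)}"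
      using g carrier_subset by blast
    then have "g = k \<or> g \<otimes> g = z \<or> g \<otimes> g = w"
      by (elim insertE emptyE) (simp_all add: normal_form)
    with sq z_neq k show ?thesis by auto
  qed
  then show ?thesis
    by (auto simp: square_trivial_def numeral_2_eq_2)
qed

section \<open>The commutative group algebra \<open>FZ\<close>\<close>

lemma sum_Z_mult:
  fixes f :: "_ \<Rightarrow> 'c::comm_monoid_add"
  assumes "j \<in> Z"
  shows "(\<Sum>k\<in>Z. f (j \<otimes> k)) = (\<Sum>k\<in>Z. f k)"
  by (rule sum.reindex_bij_witness[where i = "(\<otimes>) j" and j = "(\<otimes>) j"]) (use assms in auto)

text \<open>The product of \<open>FZ\<close>. As every \<open>k\<close> in \<open>Z\<close> is its
  own inverse, the pairs with product \<open>j\<close> are exactly \<open>(j k, k)\<close>.\<close>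

definition conv :: "('a \<Rightarrow> 'f::field) \<Rightarrow> ('a \<Rightarrow> 'f) \<Rightarrow> 'a \<Rightarrow> 'f" (infixl "\<star>" 70) where
  "x \<star> y = (\<lambda>j. if j \<in> Z then \<Sum>k\<in>Z. x (j \<otimes> k) * y k else 0)"

text \<open>For \<open>c\<close> in \<open>Z\<close> this is multiplication by the group element
  \<open>c\<close>, which equals its inverse.\<close>

definition shift :: "'a \<Rightarrow> ('a \<Rightarrow> 'f::field) \<Rightarrow> 'a \<Rightarrow> 'f" where
  "shift c x = (\<lambda>j. if j \<in> Z then x (c \<otimes> j) else 0)"

definition \<epsilon> :: "('a \<Rightarrow> 'f::field) \<Rightarrow> 'f" where
  "\<epsilon> x = (\<Sum>k\<in>Z. x k)"

definition unit :: "'a \<Rightarrow> 'f::field" where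
  "unit = (\<lambda>j. if j = \<one> then 1 else 0)"

text \<open>The underlying set of \<open>FZ\<close>. Coefficient functions live on the whole type,
  and requiring the value 0 outside \<open>Z\<close> makes equality in \<open>FZ\<close> equality of
  functions.\<close>

definition R :: "('a \<Rightarrow> 'f::field) set" where
  "R = {x. \<forall>j. j \<notin> Z \<longrightarrow> x j = 0}"

definition fixed :: "'a \<Rightarrow> ('a \<Rightarrow> 'f::field) set" where
  "fixed c = {x \<in> R. shift c x = x}"

lemma conv_commute: "x \<star> y = y \<star> x"
proof (rule ext)
  fix j
  show "(x \<star> y) j = (y \<star> x) j"
  proof (cases "j \<in> Z")
    case True
    then have "(\<Sum>k\<in>Z. x (j \<otimes> k) * y k) = (\<Sum>k\<in>Z. x (j \<otimes> (j \<otimes> k)) * y (j \<otimes> k))"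
      by (subst sum_Z_mult[OF True, symmetric]) simp
    with True show ?thesis by (simp add: conv_def mult.commute)
  qed (simp add: conv_def)
qed

lemma conv_assoc: "(x \<star> y) \<star> v = x \<star> (y \<star> v)"
proof (rule ext)
  fix j
  show "((x \<star> y) \<star> v) j = (x \<star> (y \<star> v)) j"
  proof (cases "j \<in> Z")
    case j: True
    have "((x \<star> y) \<star> v) j = (\<Sum>k\<in>Z. \<Sum>l\<in>Z. x (j \<otimes> k \<otimes> l) * y l * v k)"
      using j by (simp add: conv_def sum_distrib_right)
    \<comment> \<open>Replacing the inner index \<open>l\<close> by \<open>k l\<close> cancels
      \<open>k\<close> in the argument of \<open>x\<close>, after which the two sums can be
      exchanged.\<close>
    also have "\<dots> = (\<Sum>k\<in>Z. \<Sum>l\<in>Z. x (j \<otimes> k \<otimes> (k \<otimes> l)) * y (k \<otimes> l) * v k)"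
      by (intro sum.cong HOL.refl sum_Z_mult[symmetric])
    also have "\<dots> = (\<Sum>k\<in>Z. \<Sum>l\<in>Z. x (j \<otimes> l) * y (l \<otimes> k) * v k)"
      using j by (intro sum.cong HOL.refl) (simp add: m_assoc Z_comm Z_left_comm)
    also have "\<dots> = (\<Sum>l\<in>Z. \<Sum>k\<in>Z. x (j \<otimes> l) * y (l \<otimes> k) * v k)"
      by (rule sum.swap)
    also have "\<dots> = (x \<star> (y \<star> v)) j"
      using j by (simp add: conv_def sum_distrib_left mult.assoc)
    finally show ?thesis .
  qed (simp add: conv_def)
qed

lemma conv_left_commute: "y \<star> (x \<star> v) = x \<star> (y \<star> v)"
  by (simp only: conv_assoc[symmetric] conv_commute[of y x])

lemma conv_add: "(x + y) \<star> v = x \<star> v + y \<star> v" "v \<star> (x + y) = v \<star> x + v \<star> y"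
  by (auto simp: conv_def fun_eq_iff algebra_simps sum.distrib)

lemma conv_0 [simp]: "0 \<star> v = 0" "v \<star> 0 = 0"
  by (auto simp: conv_def fun_eq_iff)

lemma shift_conv:
  fixes x y :: "'a \<Rightarrow> 'f::field"
  shows "c \<in> Z \<Longrightarrow> shift c x \<star> y = shift c (x \<star> y)" "c \<in> Z \<Longrightarrow> y \<star> shift c x = shift c (y \<star> x)"
proof -
  show eq: "shift c x \<star> y = shift c (x \<star> y)" if "c \<in> Z" for x y :: "'a \<Rightarrow> 'f"
    using that by (auto simp: shift_def conv_def fun_eq_iff m_assoc intro!: sum.cong)
  show "c \<in> Z \<Longrightarrow> y \<star> shift c x = shift c (y \<star> x)"
    using eq by (simp add: conv_commute[of y])
qed

lemma shift_add: "shift c (x + y) = shift c x + shift c y"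
  by (auto simp: shift_def fun_eq_iff)

lemma shift_commute: "c \<in> Z \<Longrightarrow> d \<in> Z \<Longrightarrow> shift c (shift d x) = shift d (shift c x)"
  by (auto simp: shift_def fun_eq_iff Z_left_comm)

lemma shift_shift: "c \<in> Z \<Longrightarrow> x \<in> R \<Longrightarrow> shift c (shift c x) = x"
  by (auto simp: shift_def R_def fun_eq_iff)

lemma unit_conv: "x \<in> R \<Longrightarrow> unit \<star> x = x"
proof (rule ext)
  fix j assume "x \<in> R"
  moreover have "(unit \<star> x) j = x j" if j: "j \<in> Z"
  proof -
    have "j \<otimes> k = \<one> \<longleftrightarrow> k = j" if "k \<in> Z" for k
      using that j Z_square'[of j k] by (metis Z_carrier r_one square_Z)
    then have "(unit \<star> x) j = (\<Sum>k\<in>Z. if k = j then x k else 0)"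
      unfolding conv_def unit_def using j by (auto intro!: sum.cong)
    with j show ?thesis by (simp add: finite_Z)
  qed
  ultimately show "(unit \<star> x) j = x j" by (cases "j \<in> Z") (auto simp: conv_def R_def)
qed

lemma R_closed [simp]: "x \<star> y \<in> R" "shift c x \<in> R" "x \<in> R \<Longrightarrow> y \<in> R \<Longrightarrow> x + y \<in> R"
  by (auto simp: R_def conv_def shift_def)

lemma \<epsilon>_add: "\<epsilon> (x + y) = \<epsilon> x + \<epsilon> y"
  by (simp add: \<epsilon>_def sum.distrib)

lemma \<epsilon>_shift: "c \<in> Z \<Longrightarrow> \<epsilon> (shift c x) = \<epsilon> x"
  using sum_Z_mult[of c x] by (simp add: \<epsilon>_def shift_def)

lemma \<epsilon>_conv: "\<epsilon> (x \<star> y) = \<epsilon> x * \<epsilon> y"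
proof -
  have "\<epsilon> (x \<star> y) = (\<Sum>j\<in>Z. \<Sum>k\<in>Z. x (j \<otimes> k) * y k)"
    by (simp add: \<epsilon>_def conv_def)
  also have "\<dots> = (\<Sum>k\<in>Z. (\<Sum>j\<in>Z. x (k \<otimes> j)) * y k)"
    by (subst sum.swap) (simp add: sum_distrib_right Z_comm cong: sum.cong)
  also have "\<dots> = \<epsilon> x * \<epsilon> y"
    by (simp add: sum_Z_mult \<epsilon>_def sum_distrib_left)
  finally show ?thesis .
qed

text \<open>Multiplication by \<open>c\<close> is an involution of \<open>Z\<close> without fixed
  points. An injection into the naturals selects from each orbit the element with the smaller
  value.\<close>

lemma transversal:
  assumes "c \<in> Z" "c \<noteq> \<one>"
  obtains T where "T \<subseteq> Z" "Z = T \<union> (\<otimes>) c ` T" "T \<inter> (\<otimes>) c ` T = {}"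
proof -
  obtain f :: "'a \<Rightarrow> nat" where f: "inj_on f Z"
    using finite_imp_inj_to_nat_seg[OF finite_Z] by blast
  define T where "T = {k \<in> Z. f k < f (c \<otimes> k)}"
  have ne: "f k \<noteq> f (c \<otimes> k)" if "k \<in> Z" for k
    using inj_onD[OF f, of k "c \<otimes> k"] that assms by auto
  have "k \<in> T \<union> (\<otimes>) c ` T" if k: "k \<in> Z" for k
  proof (cases "f k < f (c \<otimes> k)")
    case False
    then have "c \<otimes> k \<in> T" using ne[OF k] k assms by (auto simp: T_def)
    then have "c \<otimes> (c \<otimes> k) \<in> (\<otimes>) c ` T" by blast
    with k assms show ?thesis by simp
  qed (use k in \<open>simp add: T_def\<close>)
  then have "Z = T \<union> (\<otimes>) c ` T" using assms by (auto simp: T_def)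
  moreover have "T \<inter> (\<otimes>) c ` T = {}" using assms by (auto simp: T_def)
  moreover have "T \<subseteq> Z" by (auto simp: T_def)
  ultimately show ?thesis using that by blast
qed

text \<open>A fixed element is constant on the orbits \<open>{j, c j}\<close>. It is therefore given
  by arbitrary values on a transversal, which has half the size of \<open>Z\<close>.\<close>

lemma card_fixed:
  assumes c: "c \<in> Z" "c \<noteq> \<one>"
  shows "even (card Z)" "card (fixed c :: ('a \<Rightarrow> 'f::{field,finite}) set) = CARD('f) ^ (card Z div 2)"
proof -
  obtain T where T: "T \<subseteq> Z" "Z = T \<union> (\<otimes>) c ` T" "T \<inter> (\<otimes>) c ` T = {}"
    using transversal[OF c] .
  have fin: "finite T" using T(1) finite_Z finite_subset by blast
  have "inj_on ((\<otimes>) c) T" using T(1) c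
    by (intro inj_onI) (metis Z_carrier Z_square' subsetD)
  then have card: "card Z = 2 * card T"
    using T(2,3) fin by (metis card_Un_disjoint card_image finite_imageI mult_2)
  then show "even (card Z)" by simp
  have "bij_betw (\<lambda>x. restrict x T) (fixed c :: ('a \<Rightarrow> 'f) set) (T \<rightarrow>\<^sub>E (UNIV :: 'f set))"
  proof (rule bij_betw_byWitness[where f' = "\<lambda>p j. if j \<in> T then p j else if j \<in> Z then p (c \<otimes> j) else 0"])
    have other: "c \<otimes> j \<in> T \<longleftrightarrow> j \<notin> T" if "j \<in> Z" for j
    proof
      show "c \<otimes> j \<in> T \<Longrightarrow> j \<notin> T" using T(3) by blast
      show "c \<otimes> j \<in> T" if "j \<notin> T"
      proof -
        have "j \<in> (\<otimes>) c ` T" using \<open>j \<in> Z\<close> that T(2) by blast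
        then show ?thesis using T(1) c by auto
      qed
    qed
    show "\<forall>x\<in>(fixed c :: ('a \<Rightarrow> 'f) set). (\<lambda>j. if j \<in> T then restrict x T j else if j \<in> Z then restrict x T (c \<otimes> j) else 0) = x"
    proof (intro ballI ext)
      fix x :: "'a \<Rightarrow> 'f" and j assume "x \<in> fixed c"
      then have "shift c x j = x j" "j \<notin> Z \<Longrightarrow> x j = 0" by (simp_all add: fixed_def R_def)
      then show "(if j \<in> T then restrict x T j else if j \<in> Z then restrict x T (c \<otimes> j) else 0) = x j"
        using other[of j] by (auto simp: shift_def)
    qed
    show "\<forall>p\<in>T \<rightarrow>\<^sub>E UNIV. restrict (\<lambda>j. if j \<in> T then p j else if j \<in> Z then p (c \<otimes> j) else 0) T = p"
      by (auto simp: fun_eq_iff PiE_def extensional_def restrict_def)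
    show "(\<lambda>p j. if j \<in> T then p j else if j \<in> Z then p (c \<otimes> j) else 0) ` (T \<rightarrow>\<^sub>E UNIV) \<subseteq> (fixed c :: ('a \<Rightarrow> 'f) set)"
    proof (rule image_subsetI)
      fix p :: "'a \<Rightarrow> 'f"
      let ?x = "\<lambda>j. if j \<in> T then p j else if j \<in> Z then p (c \<otimes> j) else 0"
      have "?x \<in> R" using T(1) by (auto simp: R_def)
      moreover have "shift c ?x j = ?x j" for j
        using other[of j] T(1) c by (auto simp: shift_def)
      ultimately show "?x \<in> fixed c" by (simp add: fixed_def fun_eq_iff)
    qed
  qed auto
  then have "card (fixed c :: ('a \<Rightarrow> 'f) set) = card (T \<rightarrow>\<^sub>E (UNIV :: 'f set))"
    by (rule bij_betw_same_card)
  also have "\<dots> = CARD('f) ^ card T" by (simp add: card_PiE fin)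
  finally show "card (fixed c :: ('a \<Rightarrow> 'f) set) = CARD('f) ^ (card Z div 2)" by (simp add: card)
qed

text \<open>The coefficients away from 1 are free, and the prescribed augmentation then determines
  the coefficient at 1.\<close>

lemma card_\<epsilon>_eq:
  "card {x \<in> R. \<epsilon> x = (d :: 'f::{field,finite})} = CARD('f) ^ (card Z - 1)"
proof -
  define T where "T = Z - {\<one>}"
  have fin: "finite T" using finite_Z by (simp add: T_def)
  have mem_Z: "j \<in> Z \<longleftrightarrow> j = \<one> \<or> j \<in> T" for j by (auto simp: T_def)
  have ZT: "Z = insert \<one> T" "\<one> \<notin> T" by (auto simp: T_def)
  have \<epsilon>_T: "\<epsilon> x = x \<one> + sum x T" for x :: "'a \<Rightarrow> 'f"
    unfolding \<epsilon>_def by (subst ZT(1)) (simp add: fin ZT(2))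
  define g where "g p j = (if j \<in> T then p j else if j = \<one> then d - sum p T else 0)" for p :: "'a \<Rightarrow> 'f" and j
  have g_T: "sum (g p) T = sum p T" for p by (intro sum.cong) (auto simp: g_def)
  have "bij_betw (\<lambda>x. restrict x T) {x \<in> R. \<epsilon> x = d} (T \<rightarrow>\<^sub>E (UNIV :: 'f set))"
  proof (rule bij_betw_byWitness[where f' = g])
    show "\<forall>x\<in>{x \<in> R. \<epsilon> x = d}. g (restrict x T) = x"
      using ZT(2) by (auto simp: R_def mem_Z fun_eq_iff \<epsilon>_T g_def)
    show "\<forall>p\<in>T \<rightarrow>\<^sub>E UNIV. restrict (g p) T = p"
      by (auto simp: fun_eq_iff PiE_def extensional_def restrict_def g_def)
    show "g ` (T \<rightarrow>\<^sub>E UNIV) \<subseteq> {x \<in> R. \<epsilon> x = d}"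
      using ZT(2) by (auto simp: R_def mem_Z \<epsilon>_T g_T) (auto simp: g_def)
  qed auto
  then have "card {x \<in> R. \<epsilon> x = d} = card (T \<rightarrow>\<^sub>E (UNIV :: 'f set))"
    by (rule bij_betw_same_card)
  also have "\<dots> = CARD('f) ^ (card Z - 1)" by (simp add: card_PiE fin) (simp add: T_def)
  finally show ?thesis .
qed

end

section \<open>Counting the solutions over the centre\<close>

locale quaternion_like_char_2 = quaternion_like G Z a b
  for G (structure) and Z and a b +
  fixes F :: "'f::{field,finite} itself"
  assumes char_2: "CHAR('f) = 2"
begin

section \<open>Squares and augmentations in characteristic two\<close>

lemma add_self [simp]: "(c :: 'f) + c = 0"
  using minus_CHAR_2[OF char_2, of c c] by simp

lemma add_eq_0 [simp]: "(c :: 'f) + d = 0 \<longleftrightarrow> c = d"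
  by (simp flip: minus_CHAR_2[OF char_2])

lemma square_add: "((c :: 'f) + d)\<^sup>2 = c\<^sup>2 + d\<^sup>2"
proof -
  have "(c + d)\<^sup>2 = (c\<^sup>2 + d\<^sup>2) + (c * d + c * d)" by (simp add: power2_eq_square algebra_simps del: add_self)
  then show ?thesis by simp
qed

lemma square_sum: "finite A \<Longrightarrow> (\<Sum>x\<in>A. f x)\<^sup>2 = (\<Sum>x\<in>A. (f x :: 'f)\<^sup>2)"
  by (induction A rule: finite_induct) (simp_all add: square_add)

lemma square_eq_1: "(c :: 'f)\<^sup>2 = 1 \<longleftrightarrow> c = 1"
proof -
  have "c\<^sup>2 + 1 = (c + 1)\<^sup>2" by (simp add: square_add)
  then show ?thesis by (metis add_eq_0 power_eq_0_iff power_one)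
qed

lemma fun_add_self [simp]: "(x :: 'a \<Rightarrow> 'f) + x = 0" "x + (x + y) = y"
proof -
  show x: "x + x = 0" for x :: "'a \<Rightarrow> 'f"
    by (rule ext) (simp only: plus_fun_apply add_self zero_fun_apply)
  show "x + (x + y) = y" by (simp only: add.assoc[symmetric] x) simp
qed

text \<open>Squaring is additive in characteristic 2 and every \<open>k\<close> in \<open>Z\<close>
  has square 1, so only the coefficient at 1 survives. Concretely, for \<open>j\<close> other than 1
  the summands at \<open>k\<close> and \<open>j k\<close> are equal and cancel.\<close>

lemma conv_self: "(x :: 'a \<Rightarrow> 'f) \<star> x = (\<lambda>j. if j = \<one> then (\<epsilon> x)\<^sup>2 else 0)"
proof (rule ext)
  fix j
  have "(\<Sum>k\<in>Z. x (j \<otimes> k) * x k) = 0" if j: "j \<in> Z" "j \<noteq> \<one>"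
    by (rule sum_involution_eq_0[where h = "(\<otimes>) j"]) (use j in \<open>auto simp: mult.commute\<close>)
  then show "(x \<star> x) j = (if j = \<one> then (\<epsilon> x)\<^sup>2 else 0)"
    using square_sum[OF finite_Z, of x] by (auto simp: conv_def \<epsilon>_def power2_eq_square)
qed

lemma conv_self_0:
  fixes x :: "'a \<Rightarrow> 'f"
  assumes "\<epsilon> x = 0"
  shows "x \<star> x = 0" "x \<star> (x \<star> y) = 0"
proof -
  show "x \<star> x = 0" using assms by (simp add: conv_self fun_eq_iff)
  then show "x \<star> (x \<star> y) = 0" by (simp flip: conv_assoc)
qed

lemma conv_self_1:
  fixes x :: "'a \<Rightarrow> 'f"
  assumes "\<epsilon> x = 1" "y \<in> R"
  shows "x \<star> (x \<star> y) = y"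
proof -
  have "x \<star> x = unit" by (rule ext) (simp add: conv_self unit_def assms(1))
  then show ?thesis using assms by (simp add: unit_conv flip: conv_assoc)
qed

text \<open>The coefficients at \<open>k\<close> and \<open>c k\<close> agree, so in characteristic
  2 they cancel in pairs.\<close>

lemma \<epsilon>_fixed:
  assumes "(x :: 'a \<Rightarrow> 'f) \<in> fixed c" "c \<in> Z" "c \<noteq> \<one>"
  shows "\<epsilon> x = 0"
  unfolding \<epsilon>_def
proof (rule sum_involution_eq_0[where h = "(\<otimes>) c"])
  show "x (c \<otimes> k) + x k = 0" if "k \<in> Z" for k
  proof -
    have "shift c x k = x k" using assms(1) by (simp add: fixed_def)
    with that show ?thesis by (simp add: shift_def)
  qed
qed (use assms in auto)

text \<open>The coefficient quadruples of the unitary normalized units, as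
  \<open>comps_in_W_iff\<close> shows. The condition on the sum of augmentations also takes care of
  the coefficients of \<open>u u\<^sup>*\<close> on \<open>Z\<close>; the three fixedness conditions
  belong to the cosets of \<open>a\<close>, \<open>b\<close> and \<open>a b\<close>.\<close>

definition W :: "(('a \<Rightarrow> 'f) \<times> ('a \<Rightarrow> 'f) \<times> ('a \<Rightarrow> 'f) \<times> ('a \<Rightarrow> 'f)) set" where
  "W = {(\<alpha>, \<beta>, \<gamma>, \<delta>). \<alpha> \<in> R \<and> \<beta> \<in> R \<and> \<gamma> \<in> R \<and> \<delta> \<in> R \<and> \<epsilon> \<alpha> + \<epsilon> \<beta> + \<epsilon> \<gamma> + \<epsilon> \<delta> = 1 \<and>
    \<alpha> \<star> \<beta> + \<gamma> \<star> \<delta> \<in> fixed z \<and> \<alpha> \<star> \<gamma> + shift z (\<beta> \<star> \<delta>) \<in> fixed w \<and> \<alpha> \<star> \<delta> + \<beta> \<star> \<gamma> \<in> fixed w}"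

definition W_at :: "'f \<times> 'f \<times> 'f \<times> 'f \<Rightarrow> (('a \<Rightarrow> 'f) \<times> ('a \<Rightarrow> 'f) \<times> ('a \<Rightarrow> 'f) \<times> ('a \<Rightarrow> 'f)) set" where
  "W_at e = {(\<alpha>, \<beta>, \<gamma>, \<delta>) \<in> W. (\<epsilon> \<alpha>, \<epsilon> \<beta>, \<epsilon> \<gamma>, \<epsilon> \<delta>) = e}"

text \<open>
  If \<open>\<alpha>\<close> has augmentation 1 and \<open>\<beta>, \<gamma>, \<delta>\<close> have augmentation 0, then \<open>\<alpha>\<^sup>2 = 1\<close> and
  \<open>\<beta>\<^sup>2 = \<gamma>\<^sup>2 = \<delta>\<^sup>2 = 0\<close>. So \<open>\<beta>, \<gamma>, \<delta>\<close> can be recovered from \<open>s = \<alpha>\<beta> + \<gamma>\<delta>\<close>, \<open>r = \<alpha>\<gamma> + z\<beta>\<delta>\<close> and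
  \<open>t = \<alpha>\<delta> + \<beta>\<gamma>\<close>, starting from \<open>\<beta>\<delta> = st\<close>.
\<close>

lemma card_W_at_1:
  "card (W_at (1, 0, 0, 0)) = CARD('f) ^ (card Z - 1) * (CARD('f) ^ (card Z div 2)) ^ 3"
proof -
  define \<Phi> where "\<Phi> = (\<lambda>(\<alpha>, \<beta>, \<gamma>, \<delta>). (\<alpha> :: 'a \<Rightarrow> 'f, \<alpha> \<star> \<beta> + \<gamma> \<star> \<delta>, \<alpha> \<star> \<gamma> + shift z (\<beta> \<star> \<delta>), \<alpha> \<star> \<delta> + \<beta> \<star> \<gamma>))"
  \<comment> \<open>Since \<open>\<beta> \<star> \<delta> = s \<star> t\<close>, the equation for
    \<open>r\<close> gives \<open>\<alpha>\<gamma> = r + z s t\<close>, and multiplying by \<alpha>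
    isolates \<gamma>. With \<gamma> known, \<open>\<beta> = \<alpha>s + \<gamma>t\<close> and
    \<open>\<delta> = \<alpha>t + \<gamma>s\<close>, because the mixed terms occur twice and
    \<gamma> has square 0.\<close>
  define \<gamma>' where "\<gamma>' \<alpha> s r t = \<alpha> \<star> (r + shift z (s \<star> t))" for \<alpha> s r t :: "'a \<Rightarrow> 'f"
  define \<Psi> where "\<Psi> = (\<lambda>(\<alpha>, s, r, t). (\<alpha>, \<alpha> \<star> s + \<gamma>' \<alpha> s r t \<star> t, \<gamma>' \<alpha> s r t, \<alpha> \<star> t + \<gamma>' \<alpha> s r t \<star> s))"
  define D where "D = {\<alpha> \<in> R. \<epsilon> \<alpha> = (1 :: 'f)} \<times> (fixed z :: ('a \<Rightarrow> 'f) set) \<times> (fixed w :: ('a \<Rightarrow> 'f) set) \<times> (fixed w :: ('a \<Rightarrow> 'f) set)"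
  note ac = conv_add conv_assoc conv_commute conv_left_commute shift_conv shift_add
    add.assoc add.commute add.left_commute
  have "bij_betw \<Phi> (W_at (1, 0, 0, 0)) D"
  proof (rule bij_betw_byWitness[where f' = \<Psi>])
    show "\<forall>p\<in>W_at (1, 0, 0, 0). \<Psi> (\<Phi> p) = p"
    proof
      fix p assume p: "p \<in> W_at (1, 0, 0, 0)"
      obtain \<alpha> \<beta> \<gamma> \<delta> where p_eq: "p = (\<alpha>, \<beta>, \<gamma>, \<delta>)" by (cases p)
      with p have R [simp]: "\<alpha> \<in> R" "\<beta> \<in> R" "\<gamma> \<in> R" "\<delta> \<in> R"
        and \<epsilon>: "\<epsilon> \<alpha> = 1" "\<epsilon> \<beta> = 0" "\<epsilon> \<gamma> = 0" "\<epsilon> \<delta> = 0"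
        by (auto simp: W_at_def W_def)
      note sq = conv_self_1[OF \<epsilon>(1)] conv_self_0[OF \<epsilon>(2)] conv_self_0[OF \<epsilon>(3)] conv_self_0[OF \<epsilon>(4)]
      \<comment> \<open>Of the four products, \<open>\<alpha>\<beta>\<close> times
        \<open>\<alpha>\<delta>\<close> gives \<open>\<beta>\<delta>\<close>; each of the others
        contains the square of \<beta>, \<gamma> or \<delta>.\<close>
      have st: "(\<alpha> \<star> \<beta> + \<gamma> \<star> \<delta>) \<star> (\<alpha> \<star> \<delta> + \<beta> \<star> \<gamma>) = \<beta> \<star> \<delta>"
        by (simp add: ac sq)
      have \<gamma>: "\<gamma>' \<alpha> (\<alpha> \<star> \<beta> + \<gamma> \<star> \<delta>) (\<alpha> \<star> \<gamma> + shift z (\<beta> \<star> \<delta>)) (\<alpha> \<star> \<delta> + \<beta> \<star> \<gamma>) = \<gamma>"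
        by (simp add: \<gamma>'_def st add.assoc) (simp add: sq)
      have "\<alpha> \<star> (\<alpha> \<star> \<beta> + \<gamma> \<star> \<delta>) + \<gamma> \<star> (\<alpha> \<star> \<delta> + \<beta> \<star> \<gamma>) = \<beta>"
        "\<alpha> \<star> (\<alpha> \<star> \<delta> + \<beta> \<star> \<gamma>) + \<gamma> \<star> (\<alpha> \<star> \<beta> + \<gamma> \<star> \<delta>) = \<delta>"
        by (simp_all add: ac sq)
      then show "\<Psi> (\<Phi> p) = p"
        by (simp add: \<Phi>_def \<Psi>_def p_eq \<gamma>)
    qed
    have D_W: "\<Psi> q \<in> W_at (1, 0, 0, 0) \<and> \<Phi> (\<Psi> q) = q" if q: "q \<in> D" for q
    proof -
      obtain \<alpha> s r t where q_eq: "q = (\<alpha>, s, r, t)" by (cases q)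
      with q have fx: "s \<in> fixed z" "r \<in> fixed w" "t \<in> fixed w" and \<alpha>: "\<alpha> \<in> R" "\<epsilon> \<alpha> = 1"
        by (auto simp: D_def)
      then have R [simp]: "\<alpha> \<in> R" "s \<in> R" "r \<in> R" "t \<in> R" by (auto simp: fixed_def)
      \<comment> \<open>Fixedness forces augmentation 0 and hence square 0. So the relations used
        for recovering the quadruple are available again in the opposite direction.\<close>
      have \<epsilon>: "\<epsilon> s = 0" "\<epsilon> r = 0" "\<epsilon> t = 0"
        using fx z_neq by (auto intro: \<epsilon>_fixed)
      define \<gamma> where "\<gamma> = \<gamma>' \<alpha> s r t"
      have \<gamma>_R [simp]: "\<gamma> \<in> R" and \<epsilon>_\<gamma>: "\<epsilon> \<gamma> = 0"
        by (simp_all add: \<gamma>_def \<gamma>'_def \<epsilon>_conv \<epsilon>_add \<epsilon>_shift \<epsilon>)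
      have \<alpha>_\<gamma>: "\<alpha> \<star> \<gamma> = r + shift z (s \<star> t)"
        by (simp add: \<gamma>_def \<gamma>'_def conv_self_1 \<alpha>)
      note sq = conv_self_1[OF \<alpha>(2)] conv_self_0[OF \<epsilon>_\<gamma>] conv_self_0[OF \<epsilon>(1)] conv_self_0[OF \<epsilon>(3)]
      have s: "\<alpha> \<star> (\<alpha> \<star> s + \<gamma> \<star> t) + \<gamma> \<star> (\<alpha> \<star> t + \<gamma> \<star> s) = s"
        and t: "\<alpha> \<star> (\<alpha> \<star> t + \<gamma> \<star> s) + (\<alpha> \<star> s + \<gamma> \<star> t) \<star> \<gamma> = t"
        by (simp_all add: ac sq)
      have "(\<alpha> \<star> s + \<gamma> \<star> t) \<star> (\<alpha> \<star> t + \<gamma> \<star> s) = s \<star> t"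
        by (simp add: ac sq)
      then have r: "\<alpha> \<star> \<gamma> + shift z ((\<alpha> \<star> s + \<gamma> \<star> t) \<star> (\<alpha> \<star> t + \<gamma> \<star> s)) = r"
        by (simp add: \<alpha>_\<gamma> add.assoc)
      have \<Psi>: "\<Psi> q = (\<alpha>, \<alpha> \<star> s + \<gamma> \<star> t, \<gamma>, \<alpha> \<star> t + \<gamma> \<star> s)"
        by (simp add: \<Psi>_def q_eq \<gamma>_def)
      have "\<Psi> q \<in> W_at (1, 0, 0, 0)"
        using fx by (simp add: \<Psi> W_at_def W_def s r t \<alpha> \<epsilon> \<epsilon>_\<gamma> \<epsilon>_conv \<epsilon>_add)
      moreover have "\<Phi> (\<Psi> q) = q"
        unfolding \<Psi> by (simp add: \<Phi>_def s r t q_eq)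
      ultimately show ?thesis ..
    qed
    then show "\<forall>q\<in>D. \<Phi> (\<Psi> q) = q" "\<Psi> ` D \<subseteq> W_at (1, 0, 0, 0)" by auto
  qed (auto simp: W_at_def W_def \<Phi>_def D_def)
  then have "card (W_at (1, 0, 0, 0)) = card D" by (rule bij_betw_same_card)
  also have "\<dots> = CARD('f) ^ (card Z - 1) * (CARD('f) ^ (card Z div 2)) ^ 3"
    using z_neq by (simp add: D_def card_cartesian_product card_\<epsilon>_eq card_fixed power3_eq_cube)
  finally show ?thesis .
qed

text \<open>Adding the first two equations gives \<open>(p + s) * (q + r) = 0\<close>, and the two
  factors sum to 1, so one is 1 and the other 0. If \<open>p + s = 1\<close>, then
  \<open>q = r\<close>; the second equation becomes \<open>(p + s) * q = 0\<close>, and the third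
  leaves \<open>p * s = 0\<close>. The other case is symmetric, starting from the first
  equation.\<close>

lemma augmentation_cases:
  fixes p q r s :: 'f
  assumes "p * q + r * s = 0" "p * r + q * s = 0" "p * s + q * r = 0" and sum: "p + q + r + s = 1"
  shows "(p, q, r, s) \<in> {(1, 0, 0, 0), (0, 1, 0, 0), (0, 0, 1, 0), (0, 0, 0, 1)}"
proof -
  have eqs: "p * q = r * s" "p * r = q * s" "p * s = q * r" using assms(1-3) by simp_all
  have split: "(x = 1 \<and> y = 0) \<or> (x = 0 \<and> y = 1)" if "x * y = 0" "x + y = 1" for x y :: 'f
    using that by auto
  have "(p + s) * (q + r) = 0" using eqs by (simp add: algebra_simps)
  moreover have "(p + s) + (q + r) = 1" using sum by (simp add: algebra_simps)
  ultimately consider "p + s = 1" "q + r = 0" | "p + s = 0" "q + r = 1"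
    using split by blast
  then show ?thesis
  proof cases
    case 1
    then have q: "q = r" by simp
    have "p * q + q * s = 0" using eqs(2) q by simp
    moreover have "p * q + q * s = (p + s) * q" by (simp add: algebra_simps)
    ultimately have "q = 0" using 1 by simp
    with q eqs(3) have "p * s = 0" by simp
    from split[OF this 1(1)] \<open>q = 0\<close> q show ?thesis by auto
  next
    case 2
    then have s: "p = s" by simp
    have "p * q + r * s = 0" using eqs(1) by simp
    moreover have "p * q + r * s = (q + r) * p" using s by (simp add: algebra_simps)
    ultimately have "p = 0" using 2 by simp
    with s eqs(3) have "q * r = 0" by simp
    from split[OF this 2(2)] \<open>p = 0\<close> s show ?thesis by auto
  qed
qed

lemma fixed_shift: "(x :: 'a \<Rightarrow> 'f) \<in> fixed w \<Longrightarrow> shift z x \<in> fixed w"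
  by (simp add: fixed_def shift_commute[of w z])

text \<open>The second exchange leaves all three expressions unchanged. The first one changes only
  \<open>\<alpha>\<gamma> + z\<beta>\<delta>\<close>, into its multiple by \<open>z\<close>, and
  multiplication by \<open>z\<close> preserves \<open>fixed w\<close>.\<close>

lemma W_swap:
  assumes "(\<alpha>, \<beta>, \<gamma>, \<delta>) \<in> W"
  shows "(\<beta>, \<alpha>, \<delta>, \<gamma>) \<in> W" "(\<gamma>, \<delta>, \<alpha>, \<beta>) \<in> W"
proof -
  have "shift z (\<alpha> \<star> \<gamma> + shift z (\<beta> \<star> \<delta>)) \<in> fixed w"
    using assms by (auto simp: W_def intro: fixed_shift)
  then have "\<beta> \<star> \<delta> + shift z (\<alpha> \<star> \<gamma>) \<in> fixed w"
    by (simp add: shift_add shift_shift add.commute)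
  with assms show "(\<beta>, \<alpha>, \<delta>, \<gamma>) \<in> W"
    by (simp add: W_def conv_commute add.commute add.left_commute)
  show "(\<gamma>, \<delta>, \<alpha>, \<beta>) \<in> W"
    using assms by (simp add: W_def conv_commute add.commute add.left_commute)
qed

lemma card_W_at_swap:
  "card (W_at (p, q, r, s)) = card (W_at (q, p, s, r))"
  "card (W_at (p, q, r, s)) = card (W_at (r, s, p, q))"
proof -
  have "bij_betw (\<lambda>(\<alpha>, \<beta>, \<gamma>, \<delta>). (\<beta>, \<alpha>, \<delta>, \<gamma>)) (W_at (p, q, r, s)) (W_at (q, p, s, r))"
    by (rule bij_betw_byWitness[where f' = "\<lambda>(\<alpha>, \<beta>, \<gamma>, \<delta>). (\<beta>, \<alpha>, \<delta>, \<gamma>)"])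
      (auto simp: W_at_def intro: W_swap)
  then show "card (W_at (p, q, r, s)) = card (W_at (q, p, s, r))" by (rule bij_betw_same_card)
  have "bij_betw (\<lambda>(\<alpha>, \<beta>, \<gamma>, \<delta>). (\<gamma>, \<delta>, \<alpha>, \<beta>)) (W_at (p, q, r, s)) (W_at (r, s, p, q))"
    by (rule bij_betw_byWitness[where f' = "\<lambda>(\<alpha>, \<beta>, \<gamma>, \<delta>). (\<gamma>, \<delta>, \<alpha>, \<beta>)"])
      (auto simp: W_at_def intro: W_swap)
  then show "card (W_at (p, q, r, s)) = card (W_at (r, s, p, q))" by (rule bij_betw_same_card)
qed

text \<open>Fixed elements have augmentation 0, so applying \<epsilon> to the defining conditions
  yields the hypotheses of \<open>augmentation_cases\<close>.\<close>

lemma W_eq: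
  "W = W_at (1, 0, 0, 0) \<union> (W_at (0, 1, 0, 0) \<union> (W_at (0, 0, 1, 0) \<union> W_at (0, 0, 0, 1)))"
proof -
  have "p \<in> W_at (1, 0, 0, 0) \<union> (W_at (0, 1, 0, 0) \<union> (W_at (0, 0, 1, 0) \<union> W_at (0, 0, 0, 1)))"
    if p: "p \<in> W" for p
  proof -
    obtain \<alpha> \<beta> \<gamma> \<delta> where p_eq: "p = (\<alpha>, \<beta>, \<gamma>, \<delta>)" by (cases p)
    have fx: "\<alpha> \<star> \<beta> + \<gamma> \<star> \<delta> \<in> fixed z" "\<alpha> \<star> \<gamma> + shift z (\<beta> \<star> \<delta>) \<in> fixed w" "\<alpha> \<star> \<delta> + \<beta> \<star> \<gamma> \<in> fixed w"
      and sum: "\<epsilon> \<alpha> + \<epsilon> \<beta> + \<epsilon> \<gamma> + \<epsilon> \<delta> = 1"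
      using p by (simp_all add: p_eq W_def)
    have "\<epsilon> (\<alpha> \<star> \<beta> + \<gamma> \<star> \<delta>) = 0" "\<epsilon> (\<alpha> \<star> \<gamma> + shift z (\<beta> \<star> \<delta>)) = 0" "\<epsilon> (\<alpha> \<star> \<delta> + \<beta> \<star> \<gamma>) = 0"
      using fx z_neq by (auto intro: \<epsilon>_fixed)
    with augmentation_cases[of "\<epsilon> \<alpha>" "\<epsilon> \<beta>" "\<epsilon> \<gamma>" "\<epsilon> \<delta>"] sum
    show ?thesis using p by (auto simp: p_eq W_at_def \<epsilon>_add \<epsilon>_conv \<epsilon>_shift)
  qed
  then show ?thesis by (auto simp: W_at_def)
qed

text \<open>Infinite sets have cardinality 0 here, so the positive count in
  \<open>card_\<epsilon>_eq\<close> makes each augmentation class finite, and there are finitely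
  many classes.\<close>

lemma finite_R: "finite (R :: ('a \<Rightarrow> 'f) set)"
proof -
  have "finite {x \<in> R. \<epsilon> x = (d :: 'f)}" for d
    using card_\<epsilon>_eq[of d] by (intro card_ge_0_finite) simp
  then have "finite (\<Union>d. {x \<in> R. \<epsilon> x = (d :: 'f)})" by simp
  also have "(\<Union>d. {x \<in> R. \<epsilon> x = (d :: 'f)}) = R" by auto
  finally show ?thesis .
qed

lemma card_W: "card W = 4 * (CARD('f) ^ (card Z - 1) * (CARD('f) ^ (card Z div 2)) ^ 3)"
proof -
  have "finite W"
    by (rule finite_subset[of _ "R \<times> R \<times> R \<times> R"]) (auto simp: W_def finite_R)
  then have fin: "finite (W_at e)" for e
    by (rule rev_finite_subset) (auto simp: W_at_def)
  have disj: "W_at e \<inter> W_at e' = {}" if "e \<noteq> e'" for e e'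
    using that by (auto simp: W_at_def)
  have "card W = card (W_at (1, 0, 0, 0)) + (card (W_at (0, 1, 0, 0)) + (card (W_at (0, 0, 1, 0)) + card (W_at (0, 0, 0, 1))))"
    unfolding W_eq by (simp add: card_Un_disjoint fin Int_Un_distrib disj)
  also have "\<dots> = 4 * card (W_at (1, 0, 0, 0))"
    using card_W_at_swap(1)[of 1 0 0 0] card_W_at_swap(2)[of 1 0 0 0] card_W_at_swap(1)[of 0 0 1 0] by simp
  finally show ?thesis by (simp add: card_W_at_1)
qed

end

section \<open>The group algebra\<close>

lemma carrier_group_algebra:
  assumes "finite (carrier G)"
  shows "carrier (group_algebra G) = {x :: _ \<Rightarrow> 'f::field. supp x \<subseteq> carrier G}"
  using assms by (auto simp: group_algebra_def intro: finite_subset)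

lemma supp_outside: "supp x \<subseteq> A \<Longrightarrow> g \<notin> A \<Longrightarrow> x g = 0"
  by (auto simp: supp_def)

lemma supp_classical_involution: "supp (classical_involution G x) \<subseteq> carrier G"
  by (auto simp: supp_def classical_involution_def)

section \<open>Products and unitary units in \<open>FG\<close> for finite \<open>G\<close>\<close>

context group
begin

context
  assumes fin: "finite (carrier G)"
begin

lemma sum_mult_left:
  fixes f :: "_ \<Rightarrow> 'c::comm_monoid_add"
  assumes "g \<in> carrier G"
  shows "(\<Sum>h\<in>carrier G. f (g \<otimes> h)) = (\<Sum>h\<in>carrier G. f h)"
  by (rule sum.reindex_bij_witness[where i = "(\<otimes>) (inv g)" and j = "(\<otimes>) g"])
    (use assms in \<open>auto simp flip: m_assoc\<close>)

text \<open>For finite \<open>G\<close> both sums extend from the supports to the carrier by adding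
  zeros, and for each \<open>h\<close> only \<open>k = h\<^sup>-\<^sup>1 g\<close>
  contributes.\<close>

lemma mult_group_algebra:
  fixes x y :: "'a \<Rightarrow> 'f::field"
  assumes "supp x \<subseteq> carrier G" "supp y \<subseteq> carrier G"
  shows "(x \<otimes>\<^bsub>group_algebra G\<^esub> y) g =
    (if g \<in> carrier G then \<Sum>h\<in>carrier G. x h * y (inv h \<otimes> g) else 0)"
proof -
  have "(x \<otimes>\<^bsub>group_algebra G\<^esub> y) g = (\<Sum>h\<in>supp x. \<Sum>k\<in>supp y. if h \<otimes> k = g then x h * y k else 0)"
    by (simp add: group_algebra_def)
  also have "\<dots> = (\<Sum>h\<in>supp x. \<Sum>k\<in>carrier G. if h \<otimes> k = g then x h * y k else 0)"
    using assms fin by (intro sum.cong HOL.refl sum.mono_neutral_left) (auto simp: supp_def)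
  also have "\<dots> = (\<Sum>h\<in>carrier G. \<Sum>k\<in>carrier G. if h \<otimes> k = g then x h * y k else 0)"
    using assms fin by (intro sum.mono_neutral_left) (auto simp: supp_def intro!: sum.neutral split: if_splits)
  also have "\<dots> = (\<Sum>h\<in>carrier G. if g \<in> carrier G then x h * y (inv h \<otimes> g) else 0)"
  proof (rule sum.cong)
    fix h assume h: "h \<in> carrier G"
    show "(\<Sum>k\<in>carrier G. if h \<otimes> k = g then x h * y k else 0) =
        (if g \<in> carrier G then x h * y (inv h \<otimes> g) else 0)"
    proof (cases "g \<in> carrier G")
      case True
      have "h \<otimes> k = g \<longleftrightarrow> k = inv h \<otimes> g" if "k \<in> carrier G" for k
        using inv_solve_left[OF that h True] by metis
      then have "(\<Sum>k\<in>carrier G. if h \<otimes> k = g then x h * y k else 0) =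
          (\<Sum>k\<in>carrier G. if k = inv h \<otimes> g then x h * y k else 0)"
        by (intro sum.cong) auto
      with True h show ?thesis by (simp add: fin)
    next
      case False
      with h have "h \<otimes> k \<noteq> g" if "k \<in> carrier G" for k using that by auto
      with False show ?thesis by (auto intro: sum.neutral)
    qed
  qed simp
  finally show ?thesis by simp
qed

lemma monoid_group_algebra: "monoid (group_algebra G :: ('a \<Rightarrow> 'f::field) ring)"
proof
  let ?A = "group_algebra G :: ('a \<Rightarrow> 'f) ring"
  have one: "\<one>\<^bsub>?A\<^esub> = (\<lambda>g. if g = \<one> then 1 else 0)" by (simp add: group_algebra_def)
  note car = carrier_group_algebra[OF fin]
  show closed: "x \<otimes>\<^bsub>?A\<^esub> y \<in> carrier ?A" if "x \<in> carrier ?A" "y \<in> carrier ?A" for x y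
    using that by (auto simp: car mult_group_algebra supp_def[of "x \<otimes>\<^bsub>?A\<^esub> y"])
  show one_A: "\<one>\<^bsub>?A\<^esub> \<in> carrier ?A" by (auto simp: car one supp_def)
  show "x \<otimes>\<^bsub>?A\<^esub> y \<otimes>\<^bsub>?A\<^esub> v = x \<otimes>\<^bsub>?A\<^esub> (y \<otimes>\<^bsub>?A\<^esub> v)"
    if "x \<in> carrier ?A" "y \<in> carrier ?A" "v \<in> carrier ?A" for x y v
  proof (rule ext)
    fix g
    have s: "supp x \<subseteq> carrier G" "supp y \<subseteq> carrier G" "supp v \<subseteq> carrier G"
        "supp (x \<otimes>\<^bsub>?A\<^esub> y) \<subseteq> carrier G" "supp (y \<otimes>\<^bsub>?A\<^esub> v) \<subseteq> carrier G"
      using that closed by (simp_all add: car)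
    show "(x \<otimes>\<^bsub>?A\<^esub> y \<otimes>\<^bsub>?A\<^esub> v) g = (x \<otimes>\<^bsub>?A\<^esub> (y \<otimes>\<^bsub>?A\<^esub> v)) g"
    proof (cases "g \<in> carrier G")
      case g: True
      have "(x \<otimes>\<^bsub>?A\<^esub> y \<otimes>\<^bsub>?A\<^esub> v) g =
          (\<Sum>h\<in>carrier G. \<Sum>k\<in>carrier G. x k * y (inv k \<otimes> h) * v (inv h \<otimes> g))"
        using g s by (simp add: mult_group_algebra sum_distrib_right)
      also have "\<dots> = (\<Sum>k\<in>carrier G. \<Sum>h\<in>carrier G. x k * y (inv k \<otimes> h) * v (inv h \<otimes> g))"
        by (rule sum.swap)
      also have "\<dots> = (\<Sum>k\<in>carrier G. \<Sum>h\<in>carrier G. x k * y (inv k \<otimes> (k \<otimes> h)) * v (inv (k \<otimes> h) \<otimes> g))"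
        by (intro sum.cong HOL.refl sum_mult_left[symmetric])
      also have "\<dots> = (\<Sum>k\<in>carrier G. \<Sum>h\<in>carrier G. x k * y h * v (inv h \<otimes> (inv k \<otimes> g)))"
      proof (intro sum.cong HOL.refl)
        fix k h assume kh: "k \<in> carrier G" "h \<in> carrier G"
        have "inv k \<otimes> (k \<otimes> h) = h" using kh by (simp flip: m_assoc)
        moreover have "inv (k \<otimes> h) \<otimes> g = inv h \<otimes> (inv k \<otimes> g)"
          using kh g by (simp add: inv_mult_group m_assoc)
        ultimately show "x k * y (inv k \<otimes> (k \<otimes> h)) * v (inv (k \<otimes> h) \<otimes> g) =
            x k * y h * v (inv h \<otimes> (inv k \<otimes> g))" by simp
      qed
      also have "\<dots> = (x \<otimes>\<^bsub>?A\<^esub> (y \<otimes>\<^bsub>?A\<^esub> v)) g"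
        using g s by (simp add: mult_group_algebra sum_distrib_left mult.assoc)
      finally show ?thesis .
    qed (use s in \<open>simp add: mult_group_algebra\<close>)
  qed
  show "\<one>\<^bsub>?A\<^esub> \<otimes>\<^bsub>?A\<^esub> x = x" if x: "x \<in> carrier ?A" for x
  proof (rule ext)
    fix g
    have "(\<one>\<^bsub>?A\<^esub> \<otimes>\<^bsub>?A\<^esub> x) g = (if g \<in> carrier G then \<Sum>h\<in>carrier G. if h = \<one> then x (inv h \<otimes> g) else 0 else 0)"
      using x one_A by (subst mult_group_algebra) (auto simp: car one intro!: sum.cong)
    with x show "(\<one>\<^bsub>?A\<^esub> \<otimes>\<^bsub>?A\<^esub> x) g = x g"
      using fin by (auto simp: car supp_outside)
  qed
  show "x \<otimes>\<^bsub>?A\<^esub> \<one>\<^bsub>?A\<^esub> = x" if x: "x \<in> carrier ?A" for x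
  proof (rule ext)
    fix g
    have iff: "inv h \<otimes> g = \<one> \<longleftrightarrow> h = g" if "h \<in> carrier G" "g \<in> carrier G" for h
      using inv_solve_left'[OF one_closed that] that by auto
    have "(x \<otimes>\<^bsub>?A\<^esub> \<one>\<^bsub>?A\<^esub>) g =
        (if g \<in> carrier G then \<Sum>h\<in>carrier G. x h * (if inv h \<otimes> g = \<one> then 1 else 0) else 0)"
      using x one_A by (subst mult_group_algebra) (simp_all add: car one)
    also have "\<dots> = (if g \<in> carrier G then \<Sum>h\<in>carrier G. if h = g then x h else 0 else 0)"
      by (intro if_cong sum.cong HOL.refl) (simp add: iff)
    finally have "(x \<otimes>\<^bsub>?A\<^esub> \<one>\<^bsub>?A\<^esub>) g = \<dots>" .
    with x show "(x \<otimes>\<^bsub>?A\<^esub> \<one>\<^bsub>?A\<^esub>) g = x g"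
      using fin by (auto simp: car supp_outside)
  qed
qed

lemma finite_group_algebra: "finite (carrier (group_algebra G :: ('a \<Rightarrow> 'f::{field,finite}) ring))"
proof (rule finite_subset)
  show "finite {x :: 'a \<Rightarrow> 'f. \<forall>g. (g \<in> carrier G \<longrightarrow> x g \<in> UNIV) \<and> (g \<notin> carrier G \<longrightarrow> x g = 0)}"
    by (rule finite_set_of_finite_funs) (use fin in auto)
qed (auto simp: carrier_group_algebra[OF fin] supp_def)

text \<open>The coefficient at \<open>g\<close> collects the pairs with
  \<open>h k\<^sup>-\<^sup>1 = g\<close>, that is \<open>h = g k\<close>. In this form no inverse is
  left.\<close>

lemma mult_classical_involution:
  fixes x :: "'a \<Rightarrow> 'f::field"
  assumes "supp x \<subseteq> carrier G"
  shows "(x \<otimes>\<^bsub>group_algebra G\<^esub> classical_involution G x) g =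
    (if g \<in> carrier G then \<Sum>h\<in>carrier G. x (g \<otimes> h) * x h else 0)"
proof (cases "g \<in> carrier G")
  case g: True
  have "(x \<otimes>\<^bsub>group_algebra G\<^esub> classical_involution G x) g = (\<Sum>h\<in>carrier G. x h * x (inv g \<otimes> h))"
    unfolding mult_group_algebra[OF assms supp_classical_involution]
    using g by (auto simp: classical_involution_def inv_mult_group intro!: sum.cong)
  also have "\<dots> = (\<Sum>h\<in>carrier G. x (g \<otimes> h) * x (inv g \<otimes> (g \<otimes> h)))"
    by (rule sum_mult_left[OF g, symmetric])
  also have "\<dots> = (\<Sum>h\<in>carrier G. x (g \<otimes> h) * x h)"
    using g by (intro sum.cong HOL.refl) (simp flip: m_assoc)
  finally show ?thesis using g by simp
qed (simp add: mult_group_algebra assms supp_classical_involution)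

end

end

text \<open>Left multiplication by \<open>y\<close> is injective because \<open>x\<close> undoes it,
  hence surjective on a finite carrier. So \<open>y v = 1\<close> for some \<open>v\<close>, and
  \<open>v = x (y v) = x\<close>.\<close>

lemma (in monoid) finite_right_inverse:
  assumes "finite (carrier G)" and x: "x \<in> carrier G" and y: "y \<in> carrier G" and xy: "x \<otimes> y = \<one>"
  shows "y \<otimes> x = \<one>"
proof -
  have cancel: "x \<otimes> (y \<otimes> v) = v" if "v \<in> carrier G" for v
    using that x y xy by (simp flip: m_assoc)
  have "inj_on ((\<otimes>) y) (carrier G)" using cancel by (metis inj_onI)
  then have "(\<otimes>) y ` carrier G = carrier G"
    using y assms(1) by (intro endo_inj_surj) auto
  then obtain v where v: "v \<in> carrier G" "y \<otimes> v = \<one>" by (metis imageE one_closed)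
  with cancel[of v] x show ?thesis by simp
qed

text \<open>As \<open>FG\<close> is finite, the single equation \<open>u u\<^sup>* = 1\<close>
  already makes \<open>u\<close> a unit with inverse \<open>u\<^sup>*\<close>; it is then compared
  coefficient by coefficient.\<close>

lemma (in group) unitary_normalized_units_eq:
  assumes fin: "finite (carrier G)"
  shows "(unitary_normalized_units G :: ('a \<Rightarrow> 'f::{field,finite}) set) =
    {u. supp u \<subseteq> carrier G \<and> (\<Sum>g\<in>carrier G. u g) = 1 \<and>
      (\<forall>g\<in>carrier G. (\<Sum>h\<in>carrier G. u (g \<otimes> h) * u h) = (if g = \<one> then 1 else 0))}"
proof -
  let ?A = "group_algebra G :: ('a \<Rightarrow> 'f) ring"
  interpret A: monoid ?A by (rule monoid_group_algebra[OF fin])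
  note car = carrier_group_algebra[OF fin]
  have one: "\<one>\<^bsub>?A\<^esub> = (\<lambda>g. if g = \<one> then 1 else 0)" by (simp add: group_algebra_def)
  have inv_carrier: "classical_involution G u \<in> carrier ?A" for u :: "'a \<Rightarrow> 'f"
    by (simp add: car supp_classical_involution)
  have unitary: "u \<in> Units ?A \<and> classical_involution G u = inv\<^bsub>?A\<^esub> u \<longleftrightarrow>
      u \<in> carrier ?A \<and> u \<otimes>\<^bsub>?A\<^esub> classical_involution G u = \<one>\<^bsub>?A\<^esub>" for u
  proof
    assume "u \<in> carrier ?A \<and> u \<otimes>\<^bsub>?A\<^esub> classical_involution G u = \<one>\<^bsub>?A\<^esub>"
    then have u: "u \<in> carrier ?A" "u \<otimes>\<^bsub>?A\<^esub> classical_involution G u = \<one>\<^bsub>?A\<^esub>" by simp_all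
    with A.finite_right_inverse[OF finite_group_algebra[OF fin] u(1) inv_carrier]
    have "classical_involution G u \<otimes>\<^bsub>?A\<^esub> u = \<one>\<^bsub>?A\<^esub>" by simp
    with u inv_carrier A.inv_char[of u "classical_involution G u"]
    show "u \<in> Units ?A \<and> classical_involution G u = inv\<^bsub>?A\<^esub> u"
      by (auto simp: Units_def)
  qed (auto simp: A.Units_closed A.Units_r_inv)
  have aug: "augmentation u = (\<Sum>g\<in>carrier G. u g)" if "supp u \<subseteq> carrier G" for u :: "'a \<Rightarrow> 'f"
    unfolding augmentation_def using that fin by (intro sum.mono_neutral_left) (auto simp: supp_def)
  have prod: "u \<otimes>\<^bsub>?A\<^esub> classical_involution G u = \<one>\<^bsub>?A\<^esub> \<longleftrightarrow>
      (\<forall>g\<in>carrier G. (\<Sum>h\<in>carrier G. u (g \<otimes> h) * u h) = (if g = \<one> then 1 else 0))"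
    if "supp u \<subseteq> carrier G" for u
    using that by (auto simp: fun_eq_iff mult_classical_involution fin one)
  show ?thesis
  proof (rule Set.set_eqI)
    fix u :: "'a \<Rightarrow> 'f"
    have "u \<in> unitary_normalized_units G \<longleftrightarrow>
        augmentation u = 1 \<and> u \<in> Units ?A \<and> classical_involution G u = inv\<^bsub>?A\<^esub> u"
      by (auto simp: unitary_normalized_units_def normalized_units_def)
    also have "\<dots> \<longleftrightarrow> augmentation u = 1 \<and> supp u \<subseteq> carrier G \<and>
        u \<otimes>\<^bsub>?A\<^esub> classical_involution G u = \<one>\<^bsub>?A\<^esub>"
      by (simp only: unitary) (simp add: car)
    also have "\<dots> \<longleftrightarrow> u \<in> {u. supp u \<subseteq> carrier G \<and> (\<Sum>g\<in>carrier G. u g) = 1 \<and>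
        (\<forall>g\<in>carrier G. (\<Sum>h\<in>carrier G. u (g \<otimes> h) * u h) = (if g = \<one> then 1 else 0))}"
      by (cases "supp u \<subseteq> carrier G") (simp_all only: aug prod mem_Collect_eq simp_thms)
    finally show "u \<in> unitary_normalized_units G \<longleftrightarrow> \<dots>" .
  qed
qed

section \<open>Decomposition of \<open>FG\<close> over \<open>FZ\<close>\<close>

context quaternion_like_char_2
begin

text \<open>For \<open>y\<close> in \<open>Y\<close> this is the coefficient of \<open>y\<close>
  when \<open>u\<close> is expanded over \<open>FZ\<close> with basis \<open>Y\<close>.\<close>

definition comp :: "'a \<Rightarrow> ('a \<Rightarrow> 'f) \<Rightarrow> 'a \<Rightarrow> 'f" where
  "comp y u = (\<lambda>j. if j \<in> Z then u (j \<otimes> y) else 0)"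

definition comps :: "('a \<Rightarrow> 'f) \<Rightarrow> ('a \<Rightarrow> 'f) \<times> ('a \<Rightarrow> 'f) \<times> ('a \<Rightarrow> 'f) \<times> ('a \<Rightarrow> 'f)" where
  "comps u = (comp \<one> u, comp a u, comp b u, comp (a \<otimes> b) u)"

lemma comp_R [simp]: "comp y u \<in> R"
  by (simp add: comp_def R_def)

lemma bij_betw_comps: "bij_betw comps {u. supp u \<subseteq> carrier G} (R \<times> R \<times> R \<times> R)"
proof -
  let ?m = "\<lambda>(k, y). k \<otimes> y"
  \<comment> \<open>The last branch is meant for \<open>y = a b\<close>, the only element of
    \<open>Y\<close> that remains. The inverse map \<open>U\<close> evaluates this at the unique
    factorization \<open>g = k y\<close>.\<close>
  define \<tau> where "\<tau> = (\<lambda>(\<alpha>, \<beta>, \<gamma>, \<delta>) y. if y = \<one> then \<alpha> else if y = a then \<beta> else if y = b then \<gamma> else \<delta> :: 'a \<Rightarrow> 'f)"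
  define U where "U = (\<lambda>p g. if g \<in> carrier G then case inv_into (Z \<times> Y) ?m g of (k, y) \<Rightarrow> \<tau> p y k else 0)"
  have inj: "inj_on ?m (Z \<times> Y)" using bij_betw_carrier by (simp add: bij_betw_def)
  have U: "U p (k \<otimes> y) = \<tau> p y k" if "k \<in> Z" "y \<in> Y" for p k y
    using inv_into_f_f[OF inj, of "(k, y)"] that by (simp add: U_def)
  have Y: "\<one> \<in> Y" "a \<in> Y" "b \<in> Y" "a \<otimes> b \<in> Y" by (simp_all add: Y_def)
  have \<tau>: "\<tau> (comps u) y k = u (k \<otimes> y)" if "k \<in> Z" "y \<in> Y" for u k y
    using that Y_distinct by (auto simp: \<tau>_def comps_def comp_def Y_def)
  show ?thesis
  proof (rule bij_betw_byWitness[where f' = U])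
    show "\<forall>u\<in>{u. supp u \<subseteq> carrier G}. U (comps u) = u"
    proof (intro ballI ext)
      fix u :: "'a \<Rightarrow> 'f" and g assume u: "u \<in> {u. supp u \<subseteq> carrier G}"
      show "U (comps u) g = u g"
      proof (cases "g \<in> carrier G")
        case True
        then obtain k y where "k \<in> Z" "y \<in> Y" "g = k \<otimes> y"
          using bij_betw_imp_surj_on[OF bij_betw_carrier] by force
        then show ?thesis by (simp add: U \<tau>)
      qed (use u in \<open>simp add: U_def supp_outside\<close>)
    qed
    show "\<forall>p\<in>R \<times> R \<times> R \<times> R. comps (U p) = p"
    proof
      fix p :: "('a \<Rightarrow> 'f) \<times> ('a \<Rightarrow> 'f) \<times> ('a \<Rightarrow> 'f) \<times> ('a \<Rightarrow> 'f)"
      assume p: "p \<in> R \<times> R \<times> R \<times> R"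
      have "comp y (U p) = \<tau> p y" if "y \<in> Y" "\<tau> p y \<in> R" for y
        using that by (auto simp: comp_def fun_eq_iff U R_def)
      with p Y Y_distinct show "comps (U p) = p"
        by (auto simp: comps_def \<tau>_def)
    qed
  qed (auto simp: U_def supp_def comps_def split: if_splits)
qed

text \<open>In characteristic 2 a sum of two terms vanishes exactly when they are equal. This links
  vanishing coefficients of \<open>u u\<^sup>*\<close> to the conditions in
  \<open>W\<close>.\<close>

lemma fixed_iff:
  "(x :: 'a \<Rightarrow> 'f) \<in> R \<Longrightarrow> x \<in> fixed c \<longleftrightarrow> (\<forall>j\<in>Z. (x + shift c x) j = 0)"
  by (auto simp: fixed_def fun_eq_iff) (auto simp: shift_def R_def)

lemma mult_not_one: "k \<in> Z \<Longrightarrow> y \<in> {a, b, a \<otimes> b} \<Longrightarrow> k \<otimes> y \<noteq> \<one>"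
proof
  assume "k \<in> Z" "y \<in> {a, b, a \<otimes> b}" "k \<otimes> y = \<one>"
  then have "\<one> = y" by (intro Y_inj[of \<one> y k]) (auto simp: Y_def)
  with \<open>y \<in> {a, b, a \<otimes> b}\<close> Y_distinct show False by auto
qed

text \<open>Here \<open>C g\<close> is the coefficient of \<open>g\<close> in
  \<open>u u\<^sup>*\<close>. On the cosets of \<open>a\<close>, \<open>b\<close> and
  \<open>a b\<close> it is given by \<open>P + z P\<close>, \<open>Q + w Q\<close> and
  \<open>T + w T\<close>. On \<open>Z\<close> it is a sum of four squares, which collapses to the
  squared augmentation of \<open>u\<close> at 1; as 1 is the only square root of 1, this part is
  equivalent to augmentation 1.\<close>

lemma comps_in_W_iff:
  assumes u: "supp u \<subseteq> carrier G"
  shows "comps u \<in> W \<longleftrightarrow> (\<Sum>g\<in>carrier G. u g) = 1 \<and>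
    (\<forall>g\<in>carrier G. (\<Sum>h\<in>carrier G. u (g \<otimes> h) * u h) = (if g = \<one> then 1 else 0))"
    (is "_ \<longleftrightarrow> ?aug \<and> ?unitary")
proof -
  define \<alpha> \<beta> \<gamma> \<delta> where "\<alpha> = comp \<one> u" and "\<beta> = comp a u" and "\<gamma> = comp b u" and "\<delta> = comp (a \<otimes> b) u"
  note comps = \<alpha>_def \<beta>_def \<gamma>_def \<delta>_def
  define C where "C g = (\<Sum>h\<in>carrier G. u (g \<otimes> h) * u h)" for g
  define P Q T where "P = \<alpha> \<star> \<beta> + \<gamma> \<star> \<delta>" and "Q = \<alpha> \<star> \<gamma> + shift z (\<beta> \<star> \<delta>)" and "T = \<alpha> \<star> \<delta> + \<beta> \<star> \<gamma>"
  have R: "P \<in> R" "Q \<in> R" "T \<in> R" by (simp_all add: P_def Q_def T_def)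
  have C_eq: "C g = (\<Sum>k\<in>Z. u (g \<otimes> k) * u k + u (g \<otimes> (k \<otimes> a)) * u (k \<otimes> a) +
      u (g \<otimes> (k \<otimes> b)) * u (k \<otimes> b) + u (g \<otimes> (k \<otimes> (a \<otimes> b))) * u (k \<otimes> (a \<otimes> b)))" for g
    unfolding C_def by (subst sum_carrier) (rule HOL.refl)
  have C_1: "C j = (\<alpha> \<star> \<alpha> + \<beta> \<star> \<beta> + \<gamma> \<star> \<gamma> + \<delta> \<star> \<delta>) j" if "j \<in> Z" for j
    using that unfolding C_eq comps
    by (simp add: conv_def comp_def normal_form flip: sum.distrib)
  have C_a: "C (j \<otimes> a) = (P + shift z P) j" if j: "j \<in> Z" for j
  proof -
    \<comment> \<open>The four terms are ordered as the contributions of \<open>h\<close> from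
      \<open>Z\<close>, \<open>Z a\<close>, \<open>Z b\<close> and \<open>Z (a b)\<close>; for
      instance \<open>a (k a) = z k\<close> produces the first shift. The next two computations
      follow the same pattern.\<close>
    have "P + shift z P = \<beta> \<star> \<alpha> + shift z (\<alpha> \<star> \<beta>) + \<delta> \<star> \<gamma> + shift z (\<gamma> \<star> \<delta>)"
      by (simp add: P_def shift_add conv_commute add.commute add.left_commute)
    with j show ?thesis unfolding C_eq comps
      by (simp add: conv_def shift_def comp_def normal_form flip: sum.distrib)
  qed
  have C_b: "C (j \<otimes> b) = (Q + shift w Q) j" if j: "j \<in> Z" for j
  proof -
    have "Q + shift w Q = \<gamma> \<star> \<alpha> + shift z (\<delta> \<star> \<beta>) + shift w (\<alpha> \<star> \<gamma>) + shift w (shift z (\<beta> \<star> \<delta>))"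
      by (simp add: Q_def shift_add conv_commute add.commute add.left_commute)
    with j show ?thesis unfolding C_eq comps
      by (simp add: conv_def shift_def comp_def normal_form flip: sum.distrib)
  qed
  have C_ab: "C (j \<otimes> (a \<otimes> b)) = (T + shift w T) j" if j: "j \<in> Z" for j
  proof -
    have "T + shift w T = \<delta> \<star> \<alpha> + \<gamma> \<star> \<beta> + shift w (\<beta> \<star> \<gamma>) + shift w (\<alpha> \<star> \<delta>)"
      by (simp add: T_def shift_add conv_commute add.commute add.left_commute)
    with j show ?thesis unfolding C_eq comps
      by (simp add: conv_def shift_def comp_def normal_form flip: sum.distrib)
  qed
  have aug: "(\<Sum>g\<in>carrier G. u g) = \<epsilon> \<alpha> + \<epsilon> \<beta> + \<epsilon> \<gamma> + \<epsilon> \<delta>"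
    unfolding sum_carrier by (simp add: \<epsilon>_def comps comp_def sum.distrib)
  have C_1': "C j = (if j = \<one> then (\<epsilon> \<alpha> + \<epsilon> \<beta> + \<epsilon> \<gamma> + \<epsilon> \<delta>)\<^sup>2 else 0)" if "j \<in> Z" for j
    using that by (simp add: C_1 conv_self square_add)
  have unitary: "?unitary \<longleftrightarrow> (\<forall>j\<in>Z. C j = (if j = \<one> then 1 else 0) \<and> C (j \<otimes> a) = 0 \<and> C (j \<otimes> b) = 0 \<and> C (j \<otimes> (a \<otimes> b)) = 0)"
    (is "_ \<longleftrightarrow> ?cosets")
  proof
    assume ?unitary
    then show ?cosets using mult_not_one by (auto simp: C_def)
  next
    assume cosets: ?cosets
    show ?unitary
    proof
      fix g assume "g \<in> carrier G"
      then obtain k where k: "k \<in> Z" "g \<in> {k, k \<otimes> a, k \<otimes> b, k \<otimes> (a \<otimes> b)}"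
        using carrier_subset by blast
      then have "C g = (if g = \<one> then 1 else 0)"
        using cosets mult_not_one[OF k(1)] by (elim insertE emptyE) simp_all
      then show "(\<Sum>h\<in>carrier G. u (g \<otimes> h) * u h) = (if g = \<one> then 1 else 0)"
        by (simp add: C_def)
    qed
  qed
  have "(\<forall>j\<in>Z. C j = (if j = \<one> then 1 else 0)) \<longleftrightarrow> (\<epsilon> \<alpha> + \<epsilon> \<beta> + \<epsilon> \<gamma> + \<epsilon> \<delta>)\<^sup>2 = 1"
    using C_1' Z_closed(1) by auto
  then have "?cosets \<longleftrightarrow> (\<epsilon> \<alpha> + \<epsilon> \<beta> + \<epsilon> \<gamma> + \<epsilon> \<delta>)\<^sup>2 = 1 \<and> P \<in> fixed z \<and> Q \<in> fixed w \<and> T \<in> fixed w"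
    unfolding fixed_iff[OF R(1)] fixed_iff[OF R(2)] fixed_iff[OF R(3)]
    by (simp only: ball_conj_distrib C_a C_b C_ab cong: ball_cong)
  then show ?thesis
    unfolding unitary aug square_eq_1
    by (auto simp: comps_def W_def P_def Q_def T_def comps)
qed

lemma card_unitary_normalized_units:
  "card (unitary_normalized_units G :: ('a \<Rightarrow> 'f) set) =
    4 * (CARD('f) ^ (card Z - 1) * (CARD('f) ^ (card Z div 2)) ^ 3)"
proof -
  have eq: "unitary_normalized_units G = {u \<in> {u. supp u \<subseteq> carrier G}. comps u \<in> W}"
    by (rule Set.set_eqI)
      (simp only: unitary_normalized_units_eq[OF finite_carrier] mem_Collect_eq comps_in_W_iff cong: conj_cong)
  have "comps ` unitary_normalized_units G = W"
  proof
    show "W \<subseteq> comps ` unitary_normalized_units G"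
    proof
      fix p assume "p \<in> W"
      moreover from this have "p \<in> comps ` {u. supp u \<subseteq> carrier G}"
        unfolding bij_betw_imp_surj_on[OF bij_betw_comps] by (auto simp: W_def)
      ultimately show "p \<in> comps ` unitary_normalized_units G" by (auto simp: eq)
    qed
  qed (auto simp: eq)
  moreover have "inj_on comps (unitary_normalized_units G)"
    using bij_betw_imp_inj_on[OF bij_betw_comps] by (rule inj_on_subset) (auto simp: eq)
  ultimately have "card (unitary_normalized_units G :: ('a \<Rightarrow> 'f) set) = card W"
    using card_image by metis
  then show ?thesis by (simp add: card_W)
qed

lemma card_unitary_normalized_units_powr:
  "real (card (unitary_normalized_units G :: ('a \<Rightarrow> 'f) set)) =
    4 * real CARD('f) powr (1 / 2 * (real (order G) + real (card (square_trivial G))) - 1)"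
proof -
  obtain m where m: "card Z = 2 * m"
    using card_fixed(1)[OF Z_closed(3) z_neq(1)] by blast
  have "card Z > 0" using Z_closed(1) finite_Z card_gt_0_iff by blast
  then have m_pos: "m > 0" using m by simp
  \<comment> \<open>With \<open>card Z = 2 * m\<close> the group has order \<open>8 * m\<close> and
    \<open>2 * m\<close> elements of trivial square, which gives the exponent
    \<open>5 * m - 1\<close>. The count supplies the same value as
    \<open>(2 * m - 1) + 3 * m\<close>. Positivity of \<open>m\<close> makes the subtraction on
    naturals agree with that on reals.\<close>
  have "1 / 2 * (real (order G) + real (card (square_trivial G))) - 1 = real (5 * m - 1)"
    using m m_pos by (simp add: order_eq square_trivial_eq of_nat_diff)
  moreover have "CARD('f) ^ (card Z - 1) * (CARD('f) ^ (card Z div 2)) ^ 3 = CARD('f) ^ (5 * m - 1)"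
    using m m_pos by (simp flip: power_mult power_add)
  moreover have "real CARD('f) > 0" by simp
  ultimately show ?thesis
    by (simp only: card_unitary_normalized_units powr_realpow) simp
qed

end

theorem lemma8:
  fixes G :: "('g, 'm) monoid_scheme" and E :: "('e, 'n) monoid_scheme"
  assumes "group G"
    and "elementary_abelian 2 E" and "finite (carrier E)"
    and "G \<cong> C4_semidirect_C4 \<times>\<times> E"
    and "CHAR('f::{field, finite}) = 2"
  shows "real (card (unitary_normalized_units G :: ('g \<Rightarrow> 'f) set)) =
    4 * real CARD('f) powr (1 / 2 * (real (order G) + real (card (square_trivial G))) - 1)"
proof -
  obtain Z a b where "quaternion_like C4_semidirect_C4 Z a b"
    using quaternion_like_C4_semidirect_C4 by blast
  from quaternion_like_DirProd[OF this assms(2,3)]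
  have HE: "quaternion_like (C4_semidirect_C4 \<times>\<times> E) (Z \<times> carrier E) (a, \<one>\<^bsub>E\<^esub>) (b, \<one>\<^bsub>E\<^esub>)" .
  obtain f where "f \<in> iso (C4_semidirect_C4 \<times>\<times> E) G"
    using assms(4) group.iso_set_sym[OF assms(1)] by (auto simp: is_iso_def)
  from quaternion_like_iso[OF HE assms(1) this]
  interpret quaternion_like_char_2 G "f ` (Z \<times> carrier E)" "f (a, \<one>\<^bsub>E\<^esub>)" "f (b, \<one>\<^bsub>E\<^esub>)" "TYPE('f)"
    using assms(5) by (intro quaternion_like_char_2.intro quaternion_like_char_2_axioms.intro)
  show ?thesis by (rule card_unitary_normalized_units_powr)
qed

end
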